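(* Let $M$ be a connected matroid of rank $r>0$ on a finite set $E$ with $|E|=2r+1$, such that $\operatorname{crowd}(S)\le0$ for every proper subset $S\subsetneq E$. Let $T_1,\dots,T_p$ be the inclusion-minimal nonempty crowded subsets of $E$, and suppose that $T_i\cap T_j=\emptyset$ for all $i\ne j$. Then the crowding records of crowding zero are exactly the sets of the form $\bigsqcup_{i\in I}T_i$ for $I\subseteq\{1,\dots,p\}$, and $\omega(M)=0$.
   Context: **Crowding.** For $S\subseteq E$, the crowding of $S$ is $\operatorname{crowd}(S)=|S|-2\operatorname{rank}_M(S)$; $S$ is crowded if $\operatorname{crowd}(S)\ge0$. For $T\subseteq S\subseteq E$, $T$ is a summand of $S$ if $\operatorname{rank}_M(S)=\operatorname{rank}_M(T)+\operatorname{rank}_M(S\setminus T)$. $T$ is overcrowded in $S$ if either $\operatorname{crowd}(T)>\operatorname{crowd}(S)$, or $\operatorname{crowd}(T)=\operatorname{crowd}(S)$ and $T$ is not a summand of $S$. $S$ is a crowding record if no subset of $S$ is overcrowded in $S$. **$g$ and $\omega$.** Let $n=|E|$ and let $c(M)$ be the number of connected components of $M$. Speyer's $g$-polynomial $g_M(t)\in\mathbb Z[t]$ is given as follows (in the form of Berget–Eur–Spink–Tseng, equivalent to the original $K$-theoretic definition). If $E=\emptyset$, $g_M=1$. If $M$ has a loop or a coloop, $g_M=0$. Otherwise, for each total ordering $w=(w_1,\dots,w_n)$ of $E$, let $B_w$ be the basis with $w_k\in B_w$ iff $\operatorname{rank}\{w_1,\dots,w_k\}>\operatorname{rank}\{w_1,\dots,w_{k-1}\}$.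 In $\mathbb Z[z_e:e\in E]$, let $x^w$ be the list of the $z_b$, $b\in B_w$; let $y^w$ be the list of the $-z_c$, $c\in E\setminus B_w$; let $\alpha^w=-z_{w_n}$. For a family $f=(f_w)_w$ put $\deg f=\sum_w f_w/\prod_{i=1}^{n-1}(z_{w_i}-z_{w_{i+1}})$. With $\boldsymbol e_k$ the $k$-th elementary symmetric polynomial, $$g_M(t)=(-1)^{c(M)}\sum_{i=1}^{r}(-t)^i\sum_{j=0}^{i-1}\deg\big(\alpha^j\,\boldsymbol e_{i-j-1}(-y)\,\boldsymbol e_{r-i}(x)\,\boldsymbol e_{n-r}(y)\big).$$ $\omega(M)$ is the coefficient of $t^r$ in $g_M(t)$. *)

theory Defs
  imports
    "HOL-Library.Poly_Mapping"
    "HOL-Library.Countable_Set"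
    "HOL-Computational_Algebra.Polynomial"
    "HOL-Computational_Algebra.Fraction_Field"
    "HOL-Combinatorics.Multiset_Permutations"
begin

section \<open>Matroids\<close>

locale matroid =
  fixes E :: "'a set" and indep :: "'a set \<Rightarrow> bool"
  assumes finite_ground: "finite E"
    and indep_subset_ground: "indep I \<Longrightarrow> I \<subseteq> E"
    and indep_empty: "indep {}"
    and indep_subset: "indep I \<Longrightarrow> J \<subseteq> I \<Longrightarrow> indep J"
    and indep_augment:
      "indep I \<Longrightarrow> indep J \<Longrightarrow> card J < card I \<Longrightarrow> \<exists>e\<in>I - J. indep (insert e J)"

definition mrank :: "('a set \<Rightarrow> bool) \<Rightarrow> 'a set \<Rightarrow> nat" where
  "mrank indep S = Max (card ` {I. I \<subseteq> S \<and> indep I})"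

definition basis :: "('a set \<Rightarrow> bool) \<Rightarrow> 'a set \<Rightarrow> bool" where
  "basis indep B \<longleftrightarrow> indep B \<and> (\<forall>I. indep I \<longrightarrow> B \<subseteq> I \<longrightarrow> I = B)"

definition circuit :: "'a set \<Rightarrow> ('a set \<Rightarrow> bool) \<Rightarrow> 'a set \<Rightarrow> bool" where
  "circuit E indep C \<longleftrightarrow> C \<subseteq> E \<and> \<not> indep C \<and> (\<forall>D. D \<subset> C \<longrightarrow> indep D)"

definition loop :: "'a set \<Rightarrow> ('a set \<Rightarrow> bool) \<Rightarrow> 'a \<Rightarrow> bool" where
  "loop E indep e \<longleftrightarrow> e \<in> E \<and> \<not> indep {e}"

definition coloop :: "'a set \<Rightarrow> ('a set \<Rightarrow> bool) \<Rightarrow> 'a \<Rightarrow> bool" where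
  "coloop E indep e \<longleftrightarrow> e \<in> E \<and> (\<forall>B. basis indep B \<longrightarrow> e \<in> B)"

text \<open>For a matroid this relation is an equivalence relation on the ground set (transitivity is a
  standard consequence of circuit elimination); its classes are the connected components.\<close>

definition component_rel :: "'a set \<Rightarrow> ('a set \<Rightarrow> bool) \<Rightarrow> ('a \<times> 'a) set" where
  "component_rel E indep =
     {(e, f). e \<in> E \<and> f \<in> E \<and> (e = f \<or> (\<exists>C. circuit E indep C \<and> e \<in> C \<and> f \<in> C))}"

definition num_components :: "'a set \<Rightarrow> ('a set \<Rightarrow> bool) \<Rightarrow> nat" where
  "num_components E indep = card (E // component_rel E indep)"

definition connected_matroid :: "'a set \<Rightarrow> ('a set \<Rightarrow> bool) \<Rightarrow> bool" where
  "connected_matroid E indep \<longleftrightarrow> num_components E indep = 1"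


section \<open>Crowding\<close>

definition crowd :: "('a set \<Rightarrow> bool) \<Rightarrow> 'a set \<Rightarrow> int" where
  "crowd indep S = int (card S) - 2 * int (mrank indep S)"

definition crowded :: "('a set \<Rightarrow> bool) \<Rightarrow> 'a set \<Rightarrow> bool" where
  "crowded indep S \<longleftrightarrow> crowd indep S \<ge> 0"

definition summand :: "('a set \<Rightarrow> bool) \<Rightarrow> 'a set \<Rightarrow> 'a set \<Rightarrow> bool" where
  "summand indep T S \<longleftrightarrow> T \<subseteq> S \<and> mrank indep S = mrank indep T + mrank indep (S - T)"

definition overcrowded :: "('a set \<Rightarrow> bool) \<Rightarrow> 'a set \<Rightarrow> 'a set \<Rightarrow> bool" where
  "overcrowded indep T S \<longleftrightarrow> T \<subseteq> S \<and>
     (crowd indep T > crowd indep S \<or>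
      crowd indep T = crowd indep S \<and> \<not> summand indep T S)"

definition crowding_record :: "'a set \<Rightarrow> ('a set \<Rightarrow> bool) \<Rightarrow> 'a set \<Rightarrow> bool" where
  "crowding_record E indep S \<longleftrightarrow> S \<subseteq> E \<and> \<not> (\<exists>T\<subseteq>S. overcrowded indep T S)"

definition minimal_crowded :: "'a set \<Rightarrow> ('a set \<Rightarrow> bool) \<Rightarrow> 'a set set" where
  "minimal_crowded E indep =
     {T. T \<subseteq> E \<and> T \<noteq> {} \<and> crowded indep T \<and>
         (\<forall>U. U \<subseteq> T \<longrightarrow> U \<noteq> {} \<longrightarrow> crowded indep U \<longrightarrow> U = T)}"


section \<open>The g-polynomial\<close>

text \<open>The library's polynomial mappings form an integral domain only when the set of variables is
  linearly ordered. To allow an arbitrary type of ground elements, the variable \<open>z\<^sub>e\<close> is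
  therefore the one with index \<^term>\<open>to_nat_on E e\<close>, where \<^term>\<open>to_nat_on E\<close> is a
  bijection from the finite set \<open>E\<close> to \<open>{..<card E}\<close>.\<close>

type_synonym zpoly = "(nat \<Rightarrow>\<^sub>0 nat) \<Rightarrow>\<^sub>0 int"
type_synonym zratfun = "zpoly fract"

definition zvar :: "'a set \<Rightarrow> 'a \<Rightarrow> zratfun" where
  "zvar E e = Fract (Poly_Mapping.single (Poly_Mapping.single (to_nat_on E e) 1) 1) 1"

definition elem_sym :: "nat \<Rightarrow> 'i set \<Rightarrow> ('i \<Rightarrow> 'b) \<Rightarrow> 'b::comm_ring_1" where
  "elem_sym k A v = (\<Sum>S | S \<subseteq> A \<and> card S = k. \<Prod>i\<in>S. v i)"

text \<open>Total orderings of \<open>E\<close> are the lists in \<^term>\<open>permutations_of_set E\<close>; list positions start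
  at 0, so \<open>w\<^sub>k\<close> is \<open>w ! (k - 1)\<close>.\<close>

definition order_basis :: "('a set \<Rightarrow> bool) \<Rightarrow> 'a list \<Rightarrow> 'a set" where
  "order_basis indep w =
     {w ! k | k. k < length w \<and>
        mrank indep (set (take (Suc k) w)) > mrank indep (set (take k w))}"

definition deg :: "'a set \<Rightarrow> ('a list \<Rightarrow> zratfun) \<Rightarrow> zratfun" where
  "deg E f = (\<Sum>w\<in>permutations_of_set E.
     f w / (\<Prod>i<card E - 1. zvar E (w ! i) - zvar E (w ! Suc i)))"

text \<open>The coefficients are sums of fractions, so they are elements of the field of rational
  functions in the \<open>z\<^sub>e\<close>. That they are integers is a theorem and is not built into the
  definition. The lists \<open>x\<^sup>w\<close> and \<open>y\<^sup>w\<close> are the families \<open>z\<close> on \<open>B\<^sub>w\<close> and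
  \<open>- z\<close> on \<open>E - B\<^sub>w\<close>.\<close>

definition g_poly :: "'a set \<Rightarrow> ('a set \<Rightarrow> bool) \<Rightarrow> zratfun poly" where
  "g_poly E indep =
    (if E = {} then 1
     else if \<exists>e. loop E indep e \<or> coloop E indep e then 0
     else
       (let n = card E; r = mrank indep E; t = monom 1 1;
            B = order_basis indep;
            x = zvar E; y = (\<lambda>e. - zvar E e);
            \<alpha> = (\<lambda>w. - zvar E (last w))
        in (-1) ^ num_components E indep *
           (\<Sum>i=1..r. (- t) ^ i *
             (\<Sum>j=0..i - 1.
               [: deg E (\<lambda>w. \<alpha> w ^ j
                     * elem_sym (i - j - 1) (E - B w) (\<lambda>e. - y e)
                     * elem_sym (r - i) (B w) x
                     * elem_sym (n - r) (E - B w) y) :]))))"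

definition omega :: "'a set \<Rightarrow> ('a set \<Rightarrow> bool) \<Rightarrow> zratfun" where
  "omega E indep = coeff (g_poly E indep) (mrank indep E)"

end

theory Submission
  imports Defs
begin

text \<open>Since the last element of an ordering \<open>w\<close> is never in \<open>B\<^sub>w\<close>, the coefficient of \<open>t\<^sup>r\<close> is up
  to sign the sum over \<open>w\<close> and over \<open>d \<in> E - B\<^sub>w\<close> other than \<open>w\<^sub>n\<close> of a monomial divided by
  \<open>\<Prod>i. z w\<^sub>i - z w\<^sub>i\<^sub>+\<^sub>1\<close>. Expand all these fractions as Laurent series for one fixed order of the
  variables. At the exponent vector \<open>q\<close>, with \<open>q(E) = 0\<close>, the term of \<open>w\<close> and \<open>d\<close> is
  \<open>\<Prod>i. [h(S\<^sub>i) - [d \<in> S\<^sub>i] \<ge> 0] - [w\<^sub>i < w\<^sub>i\<^sub>+\<^sub>1]\<close>, where \<open>S\<^sub>i\<close> consists of the first \<open>i\<close> elements of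
  \<open>w\<close> and \<open>h = crowd - q\<close>. Multiplying out, one sees a sum over chains \<open>C\<close> of nonempty proper
  subsets of \<open>E\<close>, because exactly one ordering refines a chain and increases inside its blocks. The
  choices of \<open>d\<close> can then be counted, and the coefficient is up to sign the sum of
  \<open>(-1) ^ |C| * (r - |Z| + rank Z)\<close> over the chains of sets with \<open>h \<ge> 0\<close>, where \<open>Z\<close> is the
  largest member of \<open>C\<close> with \<open>h = 0\<close>.

  If \<open>q \<noteq> 0\<close>, some \<open>q(b)\<close> is positive, and removing \<open>b\<close> from a set does not decrease \<open>h\<close>, which
  gives a sign-reversing involution on the chains. If \<open>q = 0\<close>, Moebius inversion in the poset of
  sets of crowding zero, where unions of minimal crowded sets play the role of the Boolean lattice,
  leaves \<open>\<Sum>I. (-1) ^ |I| * (r - (\<Sum>i\<in>I. rank T\<^sub>i))\<close>. This vanishes since there are at least two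
  \<open>T\<^sub>i\<close>: each \<open>E - {e}\<close> is crowded, so no element lies in all \<open>T\<^sub>i\<close>.\<close>

section \<open>Rank and crowding\<close>

context matroid
begin

lemma finite_indep: "indep I \<Longrightarrow> finite I"
  using finite_ground finite_subset indep_subset_ground by blast

lemma finite_indep_subsets: "finite {I. I \<subseteq> S \<and> indep I}"
  by (rule finite_subset[of _ "Pow E"]) (auto dest: indep_subset_ground simp: finite_ground)

lemma card_le_mrank: "indep I \<Longrightarrow> I \<subseteq> S \<Longrightarrow> card I \<le> mrank indep S"
  unfolding mrank_def by (intro Max_ge) (auto simp: finite_indep_subsets)

lemma mrank_attained: "\<exists>I. I \<subseteq> S \<and> indep I \<and> card I = mrank indep S"
proof -
  have "mrank indep S \<in> card ` {I. I \<subseteq> S \<and> indep I}"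
    unfolding mrank_def by (intro Max_in) (use finite_indep_subsets indep_empty in auto)
  then show ?thesis by auto
qed

lemma mrank_le_card: "finite S \<Longrightarrow> mrank indep S \<le> card S"
  by (metis card_mono mrank_attained)

lemma mrank_empty [simp]: "mrank indep {} = 0"
  using mrank_le_card[of "{}"] by simp

lemma mrank_mono: "S \<subseteq> S' \<Longrightarrow> mrank indep S \<le> mrank indep S'"
  by (metis card_le_mrank mrank_attained order_trans)

lemma indep_extend:
  assumes "indep I" "I \<subseteq> S"
  shows "\<exists>J. I \<subseteq> J \<and> J \<subseteq> S \<and> indep J \<and> card J = mrank indep S"
  using assms
proof (induction "mrank indep S - card I" arbitrary: I)
  case 0
  then show ?case using card_le_mrank[of I S] by auto
next
  case (Suc k)
  obtain K where K: "K \<subseteq> S" "indep K" "card K = mrank indep S"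
    using mrank_attained by blast
  then obtain e where e: "e \<in> K - I" "indep (insert e I)"
    using indep_augment[of K I] Suc(2,3) by force
  have "k = mrank indep S - card (insert e I)"
    using Suc(2) e finite_indep[OF Suc(3)] by auto
  moreover have "insert e I \<subseteq> S" using e K Suc.prems by auto
  ultimately obtain J where "insert e I \<subseteq> J" "J \<subseteq> S" "indep J" "card J = mrank indep S"
    using Suc.hyps(1)[of "insert e I"] e(2) by auto
  then show ?case by auto
qed

text \<open>A maximal independent subset \<open>I\<close> of the intersection extends to a maximal
  independent subset \<open>J\<close> of the union. Then \<open>J\<close> meets \<open>A\<close> and
  \<open>B\<close> in independent sets whose common part contains \<open>I\<close>.\<close>

lemma mrank_submodular:
  "mrank indep (A \<union> B) + mrank indep (A \<inter> B) \<le> mrank indep A + mrank indep B"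
proof -
  obtain I where I: "I \<subseteq> A \<inter> B" "indep I" "card I = mrank indep (A \<inter> B)"
    using mrank_attained by blast
  obtain J where J: "I \<subseteq> J" "J \<subseteq> A \<union> B" "indep J" "card J = mrank indep (A \<union> B)"
    using indep_extend[of I "A \<union> B"] I by auto
  have fin: "finite J" using J finite_indep by auto
  have "card (J \<inter> A) + card (J \<inter> B) = card ((J \<inter> A) \<union> (J \<inter> B)) + card ((J \<inter> A) \<inter> (J \<inter> B))"
    using fin by (intro card_Un_Int) auto
  moreover have "(J \<inter> A) \<union> (J \<inter> B) = J" using J by auto
  moreover have "card I \<le> card ((J \<inter> A) \<inter> (J \<inter> B))"
    using fin I J by (intro card_mono) auto
  moreover have "card (J \<inter> A) \<le> mrank indep A" "card (J \<inter> B) \<le> mrank indep B"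
    using J by (auto intro!: card_le_mrank intro: indep_subset)
  ultimately show ?thesis using I J by simp
qed

lemma mrank_insert_le: "mrank indep (insert e S) \<le> Suc (mrank indep S)"
  using mrank_submodular[of "{e}" S] mrank_le_card[of "{e}"] by simp

lemma crowd_empty [simp]: "crowd indep {} = 0"
  by (simp add: crowd_def)

lemma crowd_supermodular:
  assumes "A \<subseteq> E" "B \<subseteq> E"
  shows "crowd indep A + crowd indep B \<le> crowd indep (A \<union> B) + crowd indep (A \<inter> B)"
proof -
  have "finite A" "finite B" using assms finite_ground finite_subset by auto
  then have "card A + card B = card (A \<union> B) + card (A \<inter> B)" by (rule card_Un_Int)
  then show ?thesis using mrank_submodular[of A B] unfolding crowd_def by linarith
qed

text \<open>Greedy choice: passing to the next prefix raises the rank by 0 or 1, and by 1 exactly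
  when the new element enters the basis.\<close>

lemma card_order_basis_prefix:
  assumes "distinct w" "k \<le> length w"
  shows "card (order_basis indep w \<inter> set (take k w)) = mrank indep (set (take k w))"
  using assms(2)
proof (induction k)
  case (Suc k)
  let ?B = "order_basis indep w" and ?S = "set (take k w)"
  have S: "set (take (Suc k) w) = insert (w ! k) ?S"
    using Suc by (simp add: take_Suc_conv_app_nth)
  have notin: "w ! k \<notin> ?S"
    using Suc assms(1) by (auto simp: in_set_conv_nth nth_eq_iff_index_eq)
  have B: "w ! k \<in> ?B \<longleftrightarrow> mrank indep (insert (w ! k) ?S) > mrank indep ?S"
    using Suc assms(1) by (auto simp: order_basis_def nth_eq_iff_index_eq simp flip: S)
  have IH: "card (?B \<inter> ?S) = mrank indep ?S" using Suc by simp
  show ?case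
  proof (cases "w ! k \<in> ?B")
    case True
    then have "?B \<inter> set (take (Suc k) w) = insert (w ! k) (?B \<inter> ?S)" using S by auto
    then show ?thesis using True B IH notin S mrank_insert_le[of "w ! k" ?S] by simp
  next
    case False
    then have "?B \<inter> set (take (Suc k) w) = ?B \<inter> ?S" using S by auto
    then show ?thesis using False B IH S mrank_mono[OF subset_insertI, of ?S "w ! k"] by simp
  qed
qed simp

end

section \<open>Matroids whose proper subsets have crowding at most zero\<close>

locale barely_crowded_matroid = matroid E indep
  for E :: "'a set" and indep :: "'a set \<Rightarrow> bool" +
  fixes r :: nat
  assumes mrank_ground: "mrank indep E = r"
    and rank_pos: "r > 0"
    and card_ground: "card E = 2 * r + 1"
    and crowd_le_0: "S \<subset> E \<Longrightarrow> crowd indep S \<le> 0"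
begin

lemma crowd_ground: "crowd indep E = 1"
  by (simp add: crowd_def mrank_ground card_ground)

text \<open>There remain \<open>2 * r\<close> elements of rank at most \<open>r\<close>, which gives
  the lower bound; the upper bound is \<open>crowd_le_0\<close>.\<close>

lemma crowd_remove:
  assumes "e \<in> E"
  shows "crowd indep (E - {e}) = 0"
proof (rule antisym)
  show "crowd indep (E - {e}) \<le> 0" using assms by (intro crowd_le_0) auto
  have "mrank indep (E - {e}) \<le> r" using mrank_mono[of "E - {e}" E] mrank_ground by auto
  then show "crowd indep (E - {e}) \<ge> 0"
    using assms card_ground finite_ground by (simp add: crowd_def)
qed

lemma mrank_remove: "e \<in> E \<Longrightarrow> mrank indep (E - {e}) = r"
  using crowd_remove[of e] card_ground finite_ground by (simp add: crowd_def)

lemma crowd_remove_ge: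
  assumes "S \<subseteq> E" "e \<in> S"
  shows "crowd indep S \<le> crowd indep (S - {e}) + 1"
proof -
  have "finite S" using assms finite_ground finite_subset by auto
  then have "int (card (S - {e})) = int (card S) - 1"
    using assms(2) card_gt_0_iff[of S] by auto
  then show ?thesis using mrank_mono[of "S - {e}" S] by (auto simp: crowd_def)
qed

lemma minimal_crowded_exists:
  assumes "S \<subseteq> E" "S \<noteq> {}" "crowd indep S \<ge> 0"
  obtains T where "T \<in> minimal_crowded E indep" "T \<subseteq> S"
proof -
  let ?A = "{U. U \<subseteq> S \<and> U \<noteq> {} \<and> crowded indep U}"
  have "finite S" using assms(1) finite_ground finite_subset by auto
  then have "finite ?A" by simp
  moreover have "S \<in> ?A" using assms by (auto simp: crowded_def)
  ultimately obtain T where T: "T \<in> ?A" "\<And>U. U \<in> ?A \<Longrightarrow> U \<subseteq> T \<Longrightarrow> T = U"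
    using finite_has_minimal2[of ?A S] by auto
  then have "T \<in> minimal_crowded E indep"
    using assms(1) by (auto simp: minimal_crowded_def)
  then show thesis using that T by auto
qed

text \<open>\<open>E\<close> contains the crowded set \<open>E - {e}\<close>, which is nonempty
  because \<open>r > 0\<close>, so \<open>E\<close> is not minimal.\<close>

lemma minimal_crowded_psubset:
  assumes "T \<in> minimal_crowded E indep"
  shows "T \<subset> E"
proof (rule ccontr)
  assume "\<not> T \<subset> E"
  then have T: "T = E" using assms by (auto simp: minimal_crowded_def)
  obtain e where e: "e \<in> E" using card_ground by fastforce
  have "card (E - {e}) = 2 * r" using e card_ground finite_ground by simp
  then have "E - {e} \<noteq> {}" using rank_pos by (metis card.empty mult_is_0 neq0_conv zero_neq_numeral)
  moreover have "crowded indep (E - {e})" using crowd_remove[OF e] by (simp add: crowded_def)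
  ultimately have "E - {e} = E" using assms T by (auto simp: minimal_crowded_def)
  then show False using e by auto
qed

lemma minimal_crowdedD:
  assumes "T \<in> minimal_crowded E indep"
  shows "T \<noteq> {}" "T \<subset> E" "crowd indep T = 0" "card T = 2 * mrank indep T"
    and "\<And>U. U \<subseteq> T \<Longrightarrow> crowd indep U \<ge> 0 \<Longrightarrow> U = {} \<or> U = T"
proof -
  show "T \<noteq> {}" using assms by (auto simp: minimal_crowded_def)
  show "T \<subset> E" using assms by (rule minimal_crowded_psubset)
  then show "crowd indep T = 0"
    using assms crowd_le_0[of T] by (auto simp: minimal_crowded_def crowded_def)
  then show "card T = 2 * mrank indep T" by (simp add: crowd_def)
  show "U = {} \<or> U = T" if "U \<subseteq> T" "crowd indep U \<ge> 0" for U
    using that assms by (auto simp: minimal_crowded_def crowded_def)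
qed

lemma finite_minimal_crowded: "finite (minimal_crowded E indep)"
  by (rule finite_subset[of _ "Pow E"]) (auto simp: minimal_crowded_def finite_ground)

end

section \<open>Disjoint minimal crowded sets and crowding records\<close>

locale disjoint_crowded_matroid = barely_crowded_matroid +
  assumes disjoint: "pairwise disjnt (minimal_crowded E indep)"
begin

abbreviation "\<T> \<equiv> minimal_crowded E indep"

lemma card_Union_minimal_crowded:
  assumes "A \<subseteq> \<T>"
  shows "card (\<Union>A) = 2 * (\<Sum>T\<in>A. mrank indep T)"
proof -
  have "card (\<Union>A) = (\<Sum>T\<in>A. card T)"
    using assms disjoint minimal_crowdedD(2) finite_ground
    by (intro card_Union_disjoint) (auto intro: pairwise_subset finite_subset)
  also have "\<dots> = (\<Sum>T\<in>A. 2 * mrank indep T)"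
    using assms minimal_crowdedD(4) by (intro sum.cong) auto
  finally show ?thesis by (simp add: sum_distrib_left)
qed

text \<open>Parity: the union has even size, while \<open>card E\<close> is odd. This makes
  \<open>crowd_le_0\<close> available for unions.\<close>

lemma Union_minimal_crowded_psubset:
  assumes "A \<subseteq> \<T>"
  shows "\<Union>A \<subset> E"
proof -
  have "\<Union>A \<subseteq> E" using assms minimal_crowdedD(2) by auto
  moreover have "card (\<Union>A) \<noteq> card E"
    using card_Union_minimal_crowded[OF assms] card_ground by presburger
  ultimately show ?thesis by auto
qed

text \<open>A proper subset has crowding at most zero. Conversely, supermodularity makes crowding
  superadditive on disjoint sets, so adding the members one at a time never makes it
  negative.\<close>

lemma crowd_Union_minimal_crowded:
  assumes "A \<subseteq> \<T>"
  shows "crowd indep (\<Union>A) = 0"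
proof (rule antisym)
  show "crowd indep (\<Union>A) \<le> 0"
    using Union_minimal_crowded_psubset[OF assms] by (rule crowd_le_0)
  have "finite A" using assms finite_minimal_crowded finite_subset by auto
  then show "crowd indep (\<Union>A) \<ge> 0"
    using assms
  proof induction
    case (insert T A)
    have "T \<inter> \<Union>A = {}"
    proof -
      have "disjnt T X" if X: "X \<in> A" for X
        using disjoint insert.prems insert.hyps(2) X by (intro pairwiseD[OF disjoint]) auto
      then show ?thesis by (auto simp: disjnt_iff)
    qed
    moreover have "T \<subseteq> E" "\<Union>A \<subseteq> E" using insert.prems minimal_crowdedD(2) by auto
    ultimately show ?case
      using crowd_supermodular[of T "\<Union>A"] insert minimal_crowdedD(3)[of T] by simp
  qed simp
qed

lemma mrank_Union_minimal_crowded: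
  "A \<subseteq> \<T> \<Longrightarrow> mrank indep (\<Union>A) = (\<Sum>T\<in>A. mrank indep T)"
  using crowd_Union_minimal_crowded[of A] card_Union_minimal_crowded[of A]
  by (simp add: crowd_def flip: of_nat_sum)

text \<open>If \<open>X\<close> meets a member \<open>T\<close>, then \<open>X \<union> T\<close> is
  proper and has crowding at most zero. By supermodularity the intersection is crowded, and
  minimality of \<open>T\<close> forces it to be all of \<open>T\<close>.\<close>

lemma crowd_0_subset_Union:
  assumes A: "A \<subseteq> \<T>" and X: "X \<subseteq> \<Union>A" "crowd indep X = 0"
  shows "X = \<Union>{T \<in> A. T \<subseteq> X}"
proof
  show "X \<subseteq> \<Union>{T \<in> A. T \<subseteq> X}"
  proof
    fix x assume x: "x \<in> X"
    then obtain T where T: "T \<in> A" "x \<in> T" using X by auto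
    have TT: "T \<in> \<T>" using T A by auto
    have sub: "X \<union> T \<subset> E" "X \<subseteq> E" "T \<subseteq> E"
      using Union_minimal_crowded_psubset[OF A] T X by auto
    have "crowd indep (X \<inter> T) \<ge> 0"
      using crowd_supermodular[OF sub(2,3)] crowd_le_0[OF sub(1)] minimal_crowdedD(3)[OF TT] X(2)
      by simp
    then have "X \<inter> T = T" using minimal_crowdedD(5)[OF TT, of "X \<inter> T"] x T by auto
    then show "x \<in> \<Union>{T \<in> A. T \<subseteq> X}" using T by auto
  qed
qed auto

lemma crowding_records_eq:
  "{S. crowding_record E indep S \<and> crowd indep S = 0} = Union ` Pow \<T>"
proof (intro set_eqI iffI)
  fix S assume "S \<in> {S. crowding_record E indep S \<and> crowd indep S = 0}"
  then have S: "S \<subseteq> E" "crowd indep S = 0"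
    and rec: "\<And>X. X \<subseteq> S \<Longrightarrow> crowd indep X = 0 \<Longrightarrow> mrank indep S = mrank indep X + mrank indep (S - X)"
    by (auto simp: crowding_record_def overcrowded_def summand_def)
  \<comment> \<open>\<open>K\<close> has crowding zero, so in a record it is a summand and
    \<open>S - K\<close> has crowding zero as well. A nonempty \<open>S - K\<close> would contain
    another minimal crowded set, which would already lie in \<open>K\<close>.\<close>
  define K where "K = \<Union>{T \<in> \<T>. T \<subseteq> S}"
  have K: "K \<subseteq> S" "crowd indep K = 0"
    unfolding K_def by (auto intro: crowd_Union_minimal_crowded)
  have "finite S" using S finite_ground finite_subset by auto
  then have "crowd indep (S - K) = 0"
    using rec[OF K] K S by (simp add: crowd_def card_Diff_subset finite_subset card_mono of_nat_diff)
  have "S - K = {}"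
  proof (rule ccontr)
    assume "S - K \<noteq> {}"
    then obtain T where T: "T \<in> \<T>" "T \<subseteq> S - K"
      using minimal_crowded_exists[of "S - K"] S \<open>crowd indep (S - K) = 0\<close> by auto
    then have "T \<subseteq> K" unfolding K_def by auto
    then show False using T minimal_crowdedD(1)[OF T(1)] by auto
  qed
  then have "S = K" using K by auto
  then show "S \<in> Union ` Pow \<T>" unfolding K_def by auto
next
  fix S assume "S \<in> Union ` Pow \<T>"
  then obtain A where A: "A \<subseteq> \<T>" "S = \<Union>A" by auto
  have S: "S \<subset> E" "crowd indep S = 0"
    using A Union_minimal_crowded_psubset crowd_Union_minimal_crowded by auto
  have "\<not> overcrowded indep X S" for X
  proof
    assume "overcrowded indep X S"
    then have X: "X \<subseteq> S" "crowd indep X > 0 \<or> crowd indep X = 0 \<and>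
        mrank indep S \<noteq> mrank indep X + mrank indep (S - X)"
      using S by (auto simp: overcrowded_def summand_def)
    then have "crowd indep X \<le> 0" using S by (intro crowd_le_0) auto
    then have X0: "crowd indep X = 0" "mrank indep S \<noteq> mrank indep X + mrank indep (S - X)"
      using X by auto
    \<comment> \<open>A subset of crowding zero is the union of a subfamily \<open>B\<close>. Ranks
      add up over disjoint minimal crowded sets, so it is a summand after all.\<close>
    define B where "B = {T \<in> A. T \<subseteq> X}"
    have XB: "X = \<Union>B" unfolding B_def using crowd_0_subset_Union[of A X] A X X0 by auto
    have B: "B \<subseteq> A" "finite A"
      using A(1) finite_minimal_crowded finite_subset by (auto simp: B_def)
    have "S - X = \<Union>(A - B)"
    proof -
      have "T \<inter> X = {}" if "T \<in> A - B" for T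
      proof -
        have "disjnt T T'" if T': "T' \<in> B" for T'
          using that \<open>T \<in> A - B\<close> A(1) B(1) by (intro pairwiseD[OF disjoint]) auto
        then show ?thesis using XB by (auto simp: disjnt_iff)
      qed
      then show ?thesis using A(2) XB by auto
    qed
    then have "mrank indep X + mrank indep (S - X) = (\<Sum>T\<in>B. mrank indep T) + (\<Sum>T\<in>A - B. mrank indep T)"
      using XB A B mrank_Union_minimal_crowded[of B] mrank_Union_minimal_crowded[of "A - B"] by auto
    also have "\<dots> = mrank indep S"
      using A mrank_Union_minimal_crowded[of A] sum.subset_diff[OF B, of "mrank indep"] by simp
    finally show False using X0 by simp
  qed
  then show "S \<in> {S. crowding_record E indep S \<and> crowd indep S = 0}"
    using S by (auto simp: crowding_record_def)
qed

text \<open>For a point \<open>f\<close> of one minimal crowded set, the crowded set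
  \<open>E - {f}\<close> contains a different one.\<close>

lemma card_minimal_crowded_ge_2: "2 \<le> card \<T>"
proof -
  have avoid: "\<exists>T\<in>\<T>. e \<notin> T" if e: "e \<in> E" for e
  proof -
    have "card (E - {e}) = 2 * r" using e card_ground finite_ground by simp
    then have "E - {e} \<noteq> {}" using rank_pos by (metis card.empty mult_is_0 neq0_conv zero_neq_numeral)
    then obtain T where "T \<in> \<T>" "T \<subseteq> E - {e}"
      using minimal_crowded_exists[of "E - {e}"] crowd_remove[OF e] by auto
    then show ?thesis by auto
  qed
  obtain e where "e \<in> E" using card_ground by fastforce
  then obtain T where T: "T \<in> \<T>" using avoid by auto
  then obtain f where f: "f \<in> T" "f \<in> E" using minimal_crowdedD(1,2)[OF T] by auto
  then obtain T' where T': "T' \<in> \<T>" "f \<notin> T'" using avoid by auto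
  have "card {T, T'} \<le> card \<T>"
    using T T' finite_minimal_crowded by (intro card_mono) auto
  moreover have "T \<noteq> T'" using f T' by auto
  ultimately show ?thesis by simp
qed

end

section \<open>Flags and chains\<close>

text \<open>The index is shifted so that the prefix ends with \<open>w ! i\<close>. The indices
  below \<open>card E - 1\<close> then correspond to the factors of the denominator in
  \<open>deg\<close> and yield nonempty proper subsets.\<close>

definition flag_set :: "'a list \<Rightarrow> nat \<Rightarrow> 'a set" where
  "flag_set w i = set (take (Suc i) w)"

lemma nth_in_flag_set_iff:
  assumes "distinct w" "i < length w"
  shows "w ! i \<in> flag_set w j \<longleftrightarrow> i \<le> j"
proof
  assume "w ! i \<in> flag_set w j"
  then obtain k where "k < length w" "k \<le> j" "w ! i = w ! k"
    unfolding flag_set_def by (auto simp: in_set_conv_nth)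
  then show "i \<le> j" using assms by (simp add: nth_eq_iff_index_eq)
next
  assume "i \<le> j"
  then show "w ! i \<in> flag_set w j"
    unfolding flag_set_def using assms by (auto simp: in_set_conv_nth intro!: exI[of _ i])
qed

lemma flag_set_eq_iff:
  assumes "distinct w" "i < length w" "j < length w"
  shows "flag_set w i = flag_set w j \<longleftrightarrow> i = j"
  using assms nth_in_flag_set_iff by (metis order_antisym order_refl)

lemma card_flag_set: "distinct w \<Longrightarrow> i < length w \<Longrightarrow> card (flag_set w i) = Suc i"
  unfolding flag_set_def by (subst distinct_card) auto

lemma flag_set_mono: "i \<le> j \<Longrightarrow> flag_set w i \<subseteq> flag_set w j"
  unfolding flag_set_def by (simp add: set_take_subset_set_take)

abbreviation proper_chain :: "'a set \<Rightarrow> 'a set set \<Rightarrow> bool" where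
  "proper_chain E \<equiv> subset.chain {S. S \<noteq> {} \<and> S \<subset> E}"

lemma flag_proper_chain:
  assumes "w \<in> permutations_of_set E" "C \<subseteq> flag_set w ` {..<card E - 1}"
  shows "proper_chain E C"
proof -
  have w: "distinct w" "set w = E" "length w = card E"
    using permutations_of_setD[OF assms(1)] distinct_card[of w] by auto
  have "flag_set w i \<noteq> {} \<and> flag_set w i \<subset> E" if "i < card E - 1" for i
  proof -
    have "flag_set w i \<subseteq> E" using w by (auto simp: flag_set_def dest: in_set_takeD)
    moreover have "card (flag_set w i) = Suc i" using w that by (intro card_flag_set) auto
    ultimately show ?thesis using that by auto
  qed
  moreover have "flag_set w i \<subseteq> flag_set w j \<or> flag_set w j \<subseteq> flag_set w i" for i j
    using flag_set_mono[of i j w] flag_set_mono[of j i w] by linarith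
  moreover have "\<exists>i<card E - 1. S = flag_set w i" if "S \<in> C" for S
    using subsetD[OF assms(2) that] by auto
  ultimately show ?thesis unfolding subset_chain_def by (metis (mono_tags, lifting) mem_Collect_eq subsetI)
qed

text \<open>The elements of a down-closed set come first in a sorted list, so
  \<open>takeWhile\<close> and \<open>filter\<close> select the same elements.\<close>

lemma sorted_wrt_set_take:
  assumes "sorted_wrt R w" "S \<subseteq> set w" "distinct w"
    and down: "\<And>x y. R x y \<Longrightarrow> x \<in> set w \<Longrightarrow> y \<in> S \<Longrightarrow> x \<in> S"
  shows "set (take (card S) w) = S"
proof -
  have "takeWhile (\<lambda>x. x \<in> S) w = filter (\<lambda>x. x \<in> S) w"
    using assms(1) down
  proof (induction w)
    case (Cons a w)
    show ?case
    proof (cases "a \<in> S")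
      case False
      then have "\<forall>x\<in>set w. x \<notin> S" using Cons.prems by auto
      then show ?thesis using False by simp
    qed (use Cons in auto)
  qed simp
  moreover have "set (filter (\<lambda>x. x \<in> S) w) = S" using assms(2) by auto
  moreover have "length (filter (\<lambda>x. x \<in> S) w) = card S"
    using distinct_card[of "filter (\<lambda>x. x \<in> S) w"] assms(3) calculation(2) by simp
  ultimately show ?thesis by (metis takeWhile_eq_take)
qed

text \<open>The ordering is the one that sorts \<open>E\<close> by the number of members of the chain that do not
  contain \<open>e\<close>, with ties broken by \<open>idx e\<close>.\<close>

lemma ex1_increasing_refinement:
  fixes idx :: "'a \<Rightarrow> nat"
  assumes fin: "finite E" and inj: "inj_on idx E" and C: "proper_chain E C"
  shows "\<exists>!w. w \<in> permutations_of_set E \<and> C \<subseteq> flag_set w ` {..<card E - 1} \<and>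
    (\<forall>i<card E - 1. flag_set w i \<notin> C \<longrightarrow> idx (w ! i) < idx (w ! Suc i))"
proof -
  obtain N where N: "\<And>e. e \<in> E \<Longrightarrow> idx e < N"
    using fin finite_nat_set_iff_bounded[of "idx ` E"] by auto
  have Csub: "S \<noteq> {}" "S \<subset> E" if "S \<in> C" for S
    using C that unfolding subset_chain_def by auto
  have finC: "finite C"
    by (rule finite_subset[of _ "Pow E"]) (use Csub fin in auto)
  define rho where "rho e = card {S \<in> C. e \<notin> S}" for e
  \<comment> \<open>The lexicographic order by \<open>rho\<close> and then \<open>idx\<close>, coded
    in one number; this is possible because \<open>idx\<close> stays below \<open>N\<close>.\<close>
  define key where "key e = rho e * N + idx e" for e
  have key_less: "key e < key f" if "rho e < rho f" "e \<in> E" for e f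
  proof -
    have "Suc (rho e) * N \<le> rho f * N" using that(1) by (intro mult_right_mono) auto
    then show ?thesis using N[OF that(2)] unfolding key_def by simp
  qed
  have inj_key: "inj_on key E"
  proof (rule inj_onI)
    fix e f assume "e \<in> E" "f \<in> E" "key e = key f"
    moreover from this have "rho e = rho f"
      using key_less[of e f] key_less[of f e] by linarith
    ultimately show "e = f" using inj by (auto simp: key_def inj_on_def)
  qed
  define w0 where "w0 = map (inv_into E key) (sorted_list_of_set (key ` E))"
  have key_w: "map key w0 = sorted_list_of_set (key ` E)"
    unfolding w0_def map_map by (rule map_idI) (use fin in \<open>auto simp: f_inv_into_f\<close>)
  have dist_w: "distinct w0"
    using distinct_sorted_list_of_set[of "key ` E"] unfolding key_w[symmetric] distinct_map by blast
  have set_w: "set w0 = E" using fin inj_key by (simp add: w0_def)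
  have perm_w: "w0 \<in> permutations_of_set E" using dist_w set_w by auto
  have sorted_w: "sorted_wrt (\<lambda>e f. key e < key f) w0"
    using strict_sorted_list_of_set[of "key ` E"] unfolding key_w[symmetric] sorted_wrt_map .
  have unique: "w = w0" if "w \<in> permutations_of_set E" "sorted_wrt (\<lambda>e f. key e < key f) w" for w
  proof -
    have w: "set w = E" using permutations_of_setD[OF that(1)] by simp
    have "map key w = map key w0"
      using that(2) sorted_w w set_w
      by (intro strict_sorted_equal[symmetric]) (simp_all only: sorted_wrt_map set_map)
    then show ?thesis
      using inj_key w set_w by (metis map_inj_on sup.idem)
  qed
  \<comment> \<open>Along an ordering that refines \<open>C\<close>, \<open>rho\<close> goes up by
    one on leaving a member of \<open>C\<close> and is constant elsewhere.\<close>
  have step: "rho (w ! Suc i) = rho (w ! i) + of_bool (flag_set w i \<in> C)"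
    if w: "w \<in> permutations_of_set E" "C \<subseteq> flag_set w ` {..<card E - 1}" and i: "i < card E - 1"
    for w i
  proof -
    have dw: "distinct w" "length w = card E"
      using permutations_of_setD[OF w(1)] distinct_card[of w] by auto
    have "{S \<in> C. w ! Suc i \<notin> S} = {S \<in> C. w ! i \<notin> S} \<union> {S \<in> C. S = flag_set w i}"
    proof -
      have "w ! Suc i \<notin> S \<longleftrightarrow> w ! i \<notin> S \<or> S = flag_set w i" if S: "S \<in> C" for S
      proof -
        obtain j where j: "j < card E - 1" "S = flag_set w j" using subsetD[OF w(2) S] by auto
        show ?thesis
          using dw i j by (auto simp: nth_in_flag_set_iff flag_set_eq_iff)
      qed
      then show ?thesis by auto
    qed
    moreover have "{S \<in> C. w ! i \<notin> S} \<inter> {S \<in> C. S = flag_set w i} = {}"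
      using dw i by (auto simp: nth_in_flag_set_iff)
    moreover have "card {S \<in> C. S = flag_set w i} = of_bool (flag_set w i \<in> C)"
    proof (cases "flag_set w i \<in> C")
      case True
      then have "{S \<in> C. S = flag_set w i} = {flag_set w i}" by auto
      then show ?thesis using True by simp
    next
      case False
      then have "{S \<in> C. S = flag_set w i} = {}" by auto
      then show ?thesis using False by simp
    qed
    ultimately show ?thesis unfolding rho_def using finC by (simp add: card_Un_disjoint)
  qed
  \<comment> \<open>Where \<open>rho\<close> jumps, \<open>key\<close> increases automatically;
    elsewhere \<open>key\<close> compares \<open>idx\<close>. So the ascent condition says that
    \<open>w\<close> is sorted by \<open>key\<close>, which determines \<open>w\<close>.\<close>
  have increasing_iff: "(\<forall>i<card E - 1. flag_set w i \<notin> C \<longrightarrow> idx (w ! i) < idx (w ! Suc i)) \<longleftrightarrow>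
      sorted_wrt (\<lambda>e f. key e < key f) w"
    if w: "w \<in> permutations_of_set E" "C \<subseteq> flag_set w ` {..<card E - 1}" for w
  proof -
    have dw: "distinct w" "length w = card E" "set w = E"
      using permutations_of_setD[OF w(1)] distinct_card[of w] by auto
    have "key (w ! i) < key (w ! Suc i) \<longleftrightarrow> (flag_set w i \<notin> C \<longrightarrow> idx (w ! i) < idx (w ! Suc i))"
      if i: "i < card E - 1" for i
    proof (cases "flag_set w i \<in> C")
      case True
      have "w ! i \<in> E" using i dw by auto
      then show ?thesis using key_less[of "w ! i" "w ! Suc i"] step[OF w i] True by simp
    next
      case False
      then show ?thesis using step[OF w i] by (simp add: key_def)
    qed
    moreover have "transp (\<lambda>e f. key e < key f)" by (auto intro: transpI)
    ultimately show ?thesis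
      using dw(2) by (simp add: sorted_wrt_iff_nth_Suc_transp less_diff_conv)
  qed
  have flag_w: "C \<subseteq> flag_set w0 ` {..<card E - 1}"
  proof
    fix S assume S: "S \<in> C"
    have "set (take (card S) w0) = S"
    proof (rule sorted_wrt_set_take[OF sorted_w])
      fix x y assume xy: "key x < key y" "x \<in> set w0" "y \<in> S"
      show "x \<in> S"
      proof (rule ccontr)
        assume x: "x \<notin> S"
        \<comment> \<open>A member missing \<open>y\<close> cannot contain \<open>S\<close>, so it
          lies inside \<open>S\<close> and misses \<open>x\<close> too. The inclusion is strict
          because \<open>S\<close> contains \<open>y\<close> but not \<open>x\<close>.\<close>
        have "{S' \<in> C. y \<notin> S'} \<subset> {S' \<in> C. x \<notin> S'}"
          using C S x xy(3) unfolding subset_chain_def by blast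
        then have "rho y < rho x" unfolding rho_def using finC by (intro psubset_card_mono) auto
        then show False using key_less[of y x] xy Csub(2)[OF S] by auto
      qed
    next
      show "S \<subseteq> set w0" using Csub(2)[OF S] set_w by blast
    qed (rule dist_w)
    moreover have "0 < card S" "card S < card E"
      using Csub[OF S] fin psubset_card_mono[OF fin] finite_subset[of S E]
      by (auto simp: card_gt_0_iff)
    ultimately show "S \<in> flag_set w0 ` {..<card E - 1}"
      unfolding flag_set_def by (intro image_eqI[of _ _ "card S - 1"]) auto
  qed
  show ?thesis
  proof (rule ex1I[of _ w0])
    show "w0 \<in> permutations_of_set E \<and> C \<subseteq> flag_set w0 ` {..<card E - 1} \<and>
        (\<forall>i<card E - 1. flag_set w0 i \<notin> C \<longrightarrow> idx (w0 ! i) < idx (w0 ! Suc i))"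
      using increasing_iff[OF perm_w flag_w] perm_w flag_w sorted_w by blast
  next
    fix w assume "w \<in> permutations_of_set E \<and> C \<subseteq> flag_set w ` {..<card E - 1} \<and>
        (\<forall>i<card E - 1. flag_set w i \<notin> C \<longrightarrow> idx (w ! i) < idx (w ! Suc i))"
    then show "w = w0" using increasing_iff[of w] unique[of w] by simp
  qed
qed

lemma finite_proper_chains: "finite E \<Longrightarrow> finite {C. proper_chain E C}"
  by (rule finite_subset[of _ "Pow (Pow E)"]) (auto simp: subset_chain_def)

text \<open>Expand each product, taking \<open>p\<close> at a set of positions and the ascent
  indicator at the others. The chosen prefixes form a chain \<open>C\<close>. By hypothesis
  \<open>W\<close>, the sum over \<open>d\<close> depends on \<open>C\<close> only, so after
  exchanging the sums it remains to count the orderings that refine \<open>C\<close> and ascend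
  elsewhere, and there is one.\<close>

lemma sum_permutations_eq_sum_chains:
  fixes idx :: "'a \<Rightarrow> nat" and p :: "'b \<Rightarrow> 'a set \<Rightarrow> int"
  assumes fin: "finite E" and inj: "inj_on idx E"
    and W: "\<And>w C. w \<in> permutations_of_set E \<Longrightarrow> C \<subseteq> flag_set w ` {..<card E - 1} \<Longrightarrow>
      (\<Sum>d\<in>D w. \<Prod>S\<in>C. p d S) = W C"
  shows "(\<Sum>w\<in>permutations_of_set E. \<Sum>d\<in>D w. \<Prod>i<card E - 1.
            p d (flag_set w i) - of_bool (idx (w ! i) < idx (w ! Suc i)))
       = (-1) ^ (card E - 1) * (\<Sum>C | proper_chain E C. (-1) ^ card C * W C)"
proof -
  let ?I = "{..<card E - 1}"
  let ?R = "\<lambda>w C. C \<subseteq> flag_set w ` ?I \<and>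
    (\<forall>i<card E - 1. flag_set w i \<notin> C \<longrightarrow> idx (w ! i) < idx (w ! Suc i))"
  have finperm: "finite (permutations_of_set E)" using fin by simp
  have "(\<Sum>d\<in>D w. \<Prod>i\<in>?I. p d (flag_set w i) - of_bool (idx (w ! i) < idx (w ! Suc i)))
      = (\<Sum>C | proper_chain E C. (-1) ^ (card E - 1) * (-1) ^ card C * W C * of_bool (?R w C))"
    if w: "w \<in> permutations_of_set E" for w
  proof -
    have dw: "distinct w" "length w = card E"
      using permutations_of_setD[OF w(1)] distinct_card[of w] by auto
    have inj_flag: "inj_on (flag_set w) ?I"
      using dw by (auto simp: inj_on_def flag_set_eq_iff)
    have "(\<Sum>d\<in>D w. \<Prod>i\<in>?I. p d (flag_set w i) - of_bool (idx (w ! i) < idx (w ! Suc i)))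
      = (\<Sum>d\<in>D w. \<Sum>J\<in>Pow ?I. (-1) ^ (card ?I - card J) * (\<Prod>i\<in>J. p d (flag_set w i))
          * (\<Prod>i\<in>?I - J. of_bool (idx (w ! i) < idx (w ! Suc i))))"
      by (subst prod_diff_conv_sum') auto
    also have "\<dots> = (\<Sum>J\<in>Pow ?I. \<Sum>d\<in>D w. (-1) ^ (card ?I - card J) * (\<Prod>i\<in>J. p d (flag_set w i))
          * (\<Prod>i\<in>?I - J. of_bool (idx (w ! i) < idx (w ! Suc i))))"
      by (rule sum.swap)
    also have "\<dots> = (\<Sum>J\<in>Pow ?I. (-1) ^ (card E - 1) * (-1) ^ card (flag_set w ` J) *
        W (flag_set w ` J) * of_bool (?R w (flag_set w ` J)))"
    proof (intro sum.cong refl)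
      fix J assume J: "J \<in> Pow ?I"
      have inj_J: "inj_on (flag_set w) J" using inj_flag J inj_on_subset by auto
      have "card J \<le> card E - 1" using J card_mono[of ?I J] by auto
      then have sgn: "(-1) ^ (card ?I - card J) = (-1) ^ (card E - 1) * (-1 :: int) ^ card (flag_set w ` J)"
      proof -
        obtain k where "card E - 1 = card J + k" using \<open>card J \<le> card E - 1\<close> le_Suc_ex by blast
        then show ?thesis
          using inj_J by (simp add: card_image power_add mult.assoc flip: power_mult_distrib)
      qed
      have "(\<Prod>i\<in>?I - J. of_bool (idx (w ! i) < idx (w ! Suc i))) =
          (of_bool (\<forall>i\<in>?I - J. idx (w ! i) < idx (w ! Suc i)) :: int)"
        by (auto simp: of_bool_def)
      \<comment> \<open>Prefixes of different lengths differ, so the positions \<open>J\<close> can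
        be recovered from the chain.\<close>
      also have "(\<forall>i\<in>?I - J. idx (w ! i) < idx (w ! Suc i)) \<longleftrightarrow> ?R w (flag_set w ` J)"
        using J inj_on_image_mem_iff[OF inj_flag] by auto
      finally have "(\<Sum>d\<in>D w. (-1) ^ (card ?I - card J) * (\<Prod>i\<in>J. p d (flag_set w i))
          * (\<Prod>i\<in>?I - J. of_bool (idx (w ! i) < idx (w ! Suc i))))
        = (-1) ^ (card ?I - card J) * (\<Sum>d\<in>D w. \<Prod>i\<in>J. p d (flag_set w i)) *
          of_bool (?R w (flag_set w ` J))"
        by (simp only: sum_distrib_left sum_distrib_right)
      also have "(\<Sum>d\<in>D w. \<Prod>i\<in>J. p d (flag_set w i)) = W (flag_set w ` J)"
        using J inj_J by (subst W[OF w, symmetric]) (auto simp: prod.reindex)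
      finally show "(\<Sum>d\<in>D w. (-1) ^ (card ?I - card J) * (\<Prod>i\<in>J. p d (flag_set w i))
          * (\<Prod>i\<in>?I - J. of_bool (idx (w ! i) < idx (w ! Suc i)))) = (-1) ^ (card E - 1) *
          (-1) ^ card (flag_set w ` J) * W (flag_set w ` J) * of_bool (?R w (flag_set w ` J))"
        unfolding sgn .
    qed
    also have "\<dots> = (\<Sum>C\<in>Pow (flag_set w ` ?I). (-1) ^ (card E - 1) * (-1) ^ card C *
        W C * of_bool (?R w C))"
      unfolding image_Pow_surj[OF refl, symmetric]
      by (subst sum.reindex[OF inj_on_image_Pow[OF inj_flag]]) simp
    also have "\<dots> = (\<Sum>C | proper_chain E C. (-1) ^ (card E - 1) * (-1) ^ card C *
        W C * of_bool (?R w C))"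
      using flag_proper_chain[OF w] finite_proper_chains[OF fin]
      by (intro sum.mono_neutral_left) auto
    finally show ?thesis .
  qed
  then have "(\<Sum>w\<in>permutations_of_set E. \<Sum>d\<in>D w. \<Prod>i\<in>?I.
            p d (flag_set w i) - of_bool (idx (w ! i) < idx (w ! Suc i)))
     = (\<Sum>w\<in>permutations_of_set E. \<Sum>C | proper_chain E C.
          (-1) ^ (card E - 1) * (-1) ^ card C * W C * of_bool (?R w C))"
    by (rule sum.cong[OF refl])
  also have "\<dots> = (\<Sum>C | proper_chain E C. \<Sum>w\<in>permutations_of_set E.
          (-1) ^ (card E - 1) * (-1) ^ card C * W C * of_bool (?R w C))"
    by (rule sum.swap)
  also have "\<dots> = (\<Sum>C | proper_chain E C. (-1) ^ (card E - 1) * ((-1) ^ card C * W C))"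
  proof (intro sum.cong refl)
    fix C assume "C \<in> {C. proper_chain E C}"
    then have C: "proper_chain E C" by simp
    define Q where "Q w \<longleftrightarrow> w \<in> permutations_of_set E \<and> ?R w C" for w
    have "\<exists>!w. Q w" unfolding Q_def by (rule ex1_increasing_refinement[OF fin inj C])
    then have "card {w. Q w} = 1" by (auto simp: card_1_singleton_iff)
    then have "card {w \<in> permutations_of_set E. ?R w C} = 1" by (simp only: Q_def)
    then have "(\<Sum>w\<in>permutations_of_set E. of_bool (?R w C)) = (1 :: int)"
      using finperm by (simp add: Int_def)
    then show "(\<Sum>w\<in>permutations_of_set E. (-1) ^ (card E - 1) * (-1) ^ card C * W C * of_bool (?R w C))
      = (-1) ^ (card E - 1) * ((-1) ^ card C * W C)"
      by (simp only: sum_distrib_left[symmetric] mult.assoc mult_1_right)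
  qed
  finally show ?thesis by (simp only: sum_distrib_left)
qed

section \<open>Alternating sums over chains\<close>

text \<open>Toggling \<open>t C\<close> pairs each set lacking it with one having it. The toggled
  element stays the same, so this is an involution, and paired terms have equal weight and opposite
  sign.\<close>

lemma sum_toggle_eq_0:
  fixes W :: "'a set \<Rightarrow> int"
  assumes fin: "finite X" "\<And>C. C \<in> X \<Longrightarrow> finite C"
    and ins: "\<And>C. C \<in> X \<Longrightarrow> t C \<notin> C \<Longrightarrow>
      insert (t C) C \<in> X \<and> t (insert (t C) C) = t C \<and> W (insert (t C) C) = W C"
    and del: "\<And>C. C \<in> X \<Longrightarrow> t C \<in> C \<Longrightarrow> C - {t C} \<in> X \<and> t (C - {t C}) = t C"
  shows "(\<Sum>C\<in>X. (-1) ^ card C * W C) = 0"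
proof -
  let ?A = "{C \<in> X. t C \<notin> C}" and ?B = "{C \<in> X. t C \<in> C}"
  have "bij_betw (\<lambda>C. insert (t C) C) ?A ?B"
    by (rule bij_betw_byWitness[where f' = "\<lambda>C. C - {t C}"]) (use ins del in auto)
  then have "(\<Sum>C\<in>?B. (-1) ^ card C * W C) =
      (\<Sum>C\<in>?A. (-1) ^ card (insert (t C) C) * W (insert (t C) C))"
    by (rule sum.reindex_bij_betw[symmetric])
  also have "\<dots> = (\<Sum>C\<in>?A. - ((-1) ^ card C * W C))"
    using fin ins by (intro sum.cong) auto
  also have "\<dots> = - (\<Sum>C\<in>?A. (-1) ^ card C * W C)"
    by (rule sum_negf)
  finally have "(\<Sum>C\<in>?A. (-1) ^ card C * W C) + (\<Sum>C\<in>?B. (-1) ^ card C * W C) = 0" by simp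
  moreover have "(\<Sum>C\<in>?A \<union> ?B. (-1) ^ card C * W C) =
      (\<Sum>C\<in>?A. (-1) ^ card C * W C) + (\<Sum>C\<in>?B. (-1) ^ card C * W C)"
    using fin by (intro sum.union_disjoint) auto
  moreover have "?A \<union> ?B = X" by auto
  ultimately show ?thesis by simp
qed

lemma sum_Pow_toggle_eq_0:
  fixes W :: "'a set \<Rightarrow> int"
  assumes "finite A" "a \<in> A" "\<And>X. X \<subseteq> A \<Longrightarrow> W (insert a X) = W X"
  shows "(\<Sum>X\<in>Pow A. (-1) ^ card X * W X) = 0"
  by (rule sum_toggle_eq_0[where t = "\<lambda>_. a"]) (use assms in \<open>auto intro: finite_subset\<close>)

text \<open>By linearity each term involves at most one element \<open>x\<close>. As
  \<open>A\<close> has two elements, some \<open>y\<close> other than \<open>x\<close> can be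
  toggled without changing that term.\<close>

lemma sum_Pow_affine_eq_0:
  fixes f :: "'a \<Rightarrow> int"
  assumes "finite A" "2 \<le> card A"
  shows "(\<Sum>X\<in>Pow A. (-1) ^ card X * (c - (\<Sum>x\<in>X. f x))) = 0"
proof -
  have "A \<noteq> {}" using assms(2) by auto
  then obtain a where a: "a \<in> A" by auto
  have const: "(\<Sum>X\<in>Pow A. (-1) ^ card X * c) = 0"
    using sum_Pow_toggle_eq_0[OF assms(1) a, of "\<lambda>_. c"] by simp
  have lin: "(\<Sum>X\<in>Pow A. (-1) ^ card X * (of_bool (x \<in> X) * f x)) = 0" if "x \<in> A" for x
  proof -
    have "A - {x} \<noteq> {}"
    proof
      assume "A - {x} = {}"
      then have "A = {x}" using that by auto
      then show False using assms(2) by simp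
    qed
    then obtain y where "y \<in> A" "y \<noteq> x" by auto
    then show ?thesis using assms(1) by (intro sum_Pow_toggle_eq_0[of _ y]) auto
  qed
  have "(\<Sum>x\<in>X. f x) = (\<Sum>x\<in>A. of_bool (x \<in> X) * f x)" if "X \<in> Pow A" for X
  proof -
    have "sum f (A \<inter> X) = (\<Sum>x\<in>A. if x \<in> X then f x else 0)"
      by (rule sum.inter_restrict[OF assms(1)])
    also have "\<dots> = (\<Sum>x\<in>A. of_bool (x \<in> X) * f x)" by (intro sum.cong) auto
    finally show ?thesis using that by (simp add: Int_absorb1)
  qed
  then have "(\<Sum>X\<in>Pow A. (-1) ^ card X * (\<Sum>x\<in>X. f x)) =
      (\<Sum>X\<in>Pow A. \<Sum>x\<in>A. (-1) ^ card X * (of_bool (x \<in> X) * f x))"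
    by (intro sum.cong refl) (simp add: sum_distrib_left)
  also have "\<dots> = (\<Sum>x\<in>A. \<Sum>X\<in>Pow A. (-1) ^ card X * (of_bool (x \<in> X) * f x))"
    by (rule sum.swap)
  also have "\<dots> = 0" using lin by simp
  finally show ?thesis using const by (simp only: right_diff_distrib sum_subtractf)
qed

text \<open>A member containing \<open>b\<close> contains \<open>t\<close>. A member avoiding
  \<open>b\<close> lies below every set of the chain that contains \<open>b\<close>, hence inside
  \<open>t\<close>.\<close>

lemma chain_toggle_in_chain:
  assumes "subset.chain P C" "\<And>S. S \<in> C \<Longrightarrow> S \<subseteq> E"
    and "t = \<Inter>{S \<in> insert E C. b \<in> S} - {b}" "t \<in> P"
  shows "subset.chain P (insert t C)"
proof -
  have "S \<subseteq> t \<or> t \<subseteq> S" if S: "S \<in> C" for S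
  proof (cases "b \<in> S")
    case True
    then show ?thesis using S assms(3) by auto
  next
    case False
    have "S \<subseteq> S'" if S': "S' \<in> insert E C" "b \<in> S'" for S'
    proof (cases "S' = E")
      case False
      then have "S \<subseteq> S' \<or> S' \<subseteq> S" using S S' assms(1) by (auto simp: subset_chain_def)
      then show ?thesis using \<open>b \<notin> S\<close> S'(2) by auto
    qed (use assms(2) S in auto)
    then show ?thesis using False assms(3) by auto
  qed
  then show ?thesis using assms(1,4) by (simp add: subset_chain_insert)
qed

section \<open>Cancellation at nonzero exponent vectors\<close>

context barely_crowded_matroid
begin

text \<open>Toggling the set obtained by removing \<open>b\<close> from the smallest member of \<open>insert E C\<close>
  containing \<open>b\<close> is a sign-reversing involution.\<close>

lemma sum_chains_eq_0:
  fixes q :: "'a \<Rightarrow> int" and F :: "'a set \<Rightarrow> int"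
  defines "h \<equiv> \<lambda>S. crowd indep S - (\<Sum>e\<in>S. q e)"
  assumes b: "b \<in> E" "q b \<ge> 1" and q: "(\<Sum>e\<in>E. q e) = 0"
  shows "(\<Sum>C | subset.chain {S. S \<noteq> {} \<and> S \<subset> E \<and> h S \<ge> 0} C.
    (-1) ^ card C * F (\<Union>{S \<in> C. h S = 0})) = 0"
proof -
  let ?P = "{S. S \<noteq> {} \<and> S \<subset> E \<and> h S \<ge> 0}"
  let ?N = "\<lambda>C. {S \<in> insert E C. b \<in> S}"
  let ?t = "\<lambda>C. \<Inter>(?N C) - {b}"
  let ?W = "\<lambda>C. F (\<Union>{S \<in> C. h S = 0})"
  \<comment> \<open>Removing \<open>b\<close> lowers the crowding by at most 1 and the sum of
    \<open>q\<close> by \<open>q b\<close>, which is at least 1.\<close>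
  have h_remove: "h S \<le> h (S - {b})" if S: "S \<subseteq> E" "b \<in> S" for S
  proof -
    have "finite S" using S finite_ground finite_subset by auto
    then have "(\<Sum>e\<in>S. q e) = q b + (\<Sum>e\<in>S - {b}. q e)"
      using S(2) by (intro sum.remove)
    then show ?thesis using crowd_remove_ge[OF S] b(2) by (simp add: h_def)
  qed
  \<comment> \<open>\<open>E\<close> serves as the smallest set containing \<open>b\<close> when no
    member of the chain does. As \<open>h E\<close> is not zero, a smallest set with
    \<open>h = 0\<close> must be a genuine member of \<open>C\<close>.\<close>
  have h_E: "h E = 1" using crowd_ground q by (simp add: h_def)
  have chainD: "S \<noteq> {}" "S \<subset> E" "h S \<ge> 0" if "subset.chain ?P C" "S \<in> C" for C S
    using that by (auto simp: subset_chain_def)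
  have finC: "finite C" if C: "subset.chain ?P C" for C
    using chainD(2)[OF C] finite_ground by (intro finite_subset[of C "Pow E"]) auto
  have M: "\<Inter>(?N C) \<in> ?N C" if C: "subset.chain ?P C" for C
  proof (rule Inter_in_chain[where \<A> = UNIV])
    show "finite (?N C)" using finC[OF C] by simp
    show "?N C \<noteq> {}" using b(1) by auto
    have "subset.chain UNIV (insert E C)"
      using C chainD(2)[OF C] by (auto simp: subset_chain_insert subset_chain_def)
    then have comparable: "\<forall>X\<in>insert E C. \<forall>Y\<in>insert E C. X \<subseteq> Y \<or> Y \<subseteq> X"
      unfolding subset_chain_def by (rule conjunct2)
    show "subset.chain UNIV (?N C)"
      unfolding subset_chain_def
    proof (intro conjI ballI subset_UNIV)
      fix X Y assume "X \<in> ?N C" "Y \<in> ?N C"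
      then show "X \<subseteq> Y \<or> Y \<subseteq> X" using comparable[THEN bspec, THEN bspec, of X Y] by simp
    qed
  qed
  have M': "\<Inter>(?N C) \<subseteq> E" "b \<in> \<Inter>(?N C)" "h (\<Inter>(?N C)) \<ge> 0" "h (\<Inter>(?N C)) = 0 \<Longrightarrow> \<Inter>(?N C) \<in> C"
    if C: "subset.chain ?P C" for C
    using M[OF C] chainD[OF C] h_E b(1) by auto
  have t_ge: "h (\<Inter>(?N C)) \<le> h (?t C)" if C: "subset.chain ?P C" for C
    using h_remove[OF M'(1,2)[OF C]] .
  \<comment> \<open>This excludes \<open>{b}\<close> as the smallest set containing
    \<open>b\<close>, so the toggled set is not empty.\<close>
  have b_neg: "h {b} < 0" and b_neq: "E \<noteq> {b}"
  proof -
    show "E \<noteq> {b}"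
    proof
      assume "E = {b}"
      then have "card E = 1" by simp
      then show False using card_ground rank_pos by simp
    qed
    then have "{b} \<subset> E" using b(1) by auto
    then show "h {b} < 0" using crowd_le_0[of "{b}"] b(2) by (simp add: h_def)
  qed
  have t_P: "?t C \<in> ?P" if C: "subset.chain ?P C" for C
  proof -
    have "?t C \<noteq> {}"
    proof
      assume "?t C = {}"
      then have "\<Inter>(?N C) = {b}" using M'(2)[OF C] by auto
      then show False using b_neg M'(3)[OF C] by simp
    qed
    moreover have "?t C \<subset> E" using M'(1)[OF C] b(1) by auto
    ultimately show ?thesis using t_ge[OF C] M'(3)[OF C] by auto
  qed
  \<comment> \<open>The toggled set avoids \<open>b\<close>, so toggling does not affect the sets
    that contain \<open>b\<close>, from which \<open>?t C\<close> is computed.\<close>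
  have N_ins_del: "?N (insert X C) = ?N C" "?N (C - {X}) = ?N C" if X: "b \<notin> X" for X C
    using X by auto
  have b_notin: "b \<notin> ?t C" for C by (metis DiffD2 singletonI)
  note N_eq = N_ins_del[OF b_notin]
  show ?thesis
  proof (rule sum_toggle_eq_0[where t = ?t])
    show "finite (Collect (subset.chain ?P))"
    proof (rule finite_subset[of _ "Pow (Pow E)"])
      show "Collect (subset.chain ?P) \<subseteq> Pow (Pow E)"
      proof
        fix C assume "C \<in> Collect (subset.chain ?P)"
        then have C: "subset.chain ?P C" by simp
        show "C \<in> Pow (Pow E)" using chainD(2)[OF C] by auto
      qed
    qed (simp add: finite_ground)
    show "finite C" if "C \<in> Collect (subset.chain ?P)" for C
      using finC that by simp
  next
    fix C assume "C \<in> Collect (subset.chain ?P)" and notin: "?t C \<notin> C"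
    then have C: "subset.chain ?P C" by simp
    have "subset.chain ?P (insert (?t C) C)"
      by (rule chain_toggle_in_chain[OF C _ refl t_P[OF C]]) (use chainD(2)[OF C] in auto)
    moreover have "\<Union>{S \<in> insert (?t C) C. h S = 0} = \<Union>{S \<in> C. h S = 0}"
    proof (cases "h (?t C) = 0")
      case True
      \<comment> \<open>The smallest set containing \<open>b\<close> has \<open>h\<close> between 0
        and \<open>h (?t C) = 0\<close>. It is therefore already in the union of the members with
        \<open>h = 0\<close> and covers \<open>?t C\<close>, so the argument of \<open>F\<close>
        does not change.\<close>
      then have h0: "h (\<Inter>(?N C)) = 0" using t_ge[OF C] M'(3)[OF C] by simp
      then have "?t C \<subseteq> \<Union>{S \<in> C. h S = 0}" using M'(4)[OF C h0] by auto
      moreover have "{S \<in> insert (?t C) C. h S = 0} = insert (?t C) {S \<in> C. h S = 0}"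
        using True by auto
      ultimately show ?thesis by (simp add: Un_absorb1)
    next
      case False
      then have "{S \<in> insert (?t C) C. h S = 0} = {S \<in> C. h S = 0}" by auto
      then show ?thesis by simp
    qed
    ultimately show "insert (?t C) C \<in> Collect (subset.chain ?P) \<and>
        ?t (insert (?t C) C) = ?t C \<and> ?W (insert (?t C) C) = ?W C"
      by (simp only: N_eq mem_Collect_eq simp_thms)
  next
    fix C assume "C \<in> Collect (subset.chain ?P)"
    then have "subset.chain ?P (C - {?t C})" by (auto simp: subset_chain_def)
    then show "C - {?t C} \<in> Collect (subset.chain ?P) \<and> ?t (C - {?t C}) = ?t C"
      by (simp only: N_eq mem_Collect_eq simp_thms)
  qed
qed

end

section \<open>Moebius inversion at the zero exponent vector\<close>

lemma sum_Pow_minus_one_power: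
  assumes "finite A" "A \<noteq> {}"
  shows "(\<Sum>X\<in>Pow A. (-1) ^ card X) = (0 :: int)"
proof -
  obtain a where "a \<in> A" using assms(2) by auto
  then show ?thesis using sum_Pow_toggle_eq_0[OF assms(1), of a "\<lambda>_. 1"] by simp
qed

context disjoint_crowded_matroid
begin

text \<open>Both sides are 1 at the empty set and satisfy the same recursion: the value at a
  nonempty \<open>K\<close> is minus the sum of the values at smaller sets. For chains, delete the
  largest member \<open>K\<close>. For families, the alternating sum over all subfamilies inside
  \<open>K\<close> vanishes, as the crowded set \<open>K\<close> contains some minimal crowded
  set.\<close>

lemma sum_chains_eq_sum_Union:
  defines "L \<equiv> {S. S \<noteq> {} \<and> S \<subset> E \<and> crowd indep S = 0}"
  assumes "K \<in> insert {} L"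
  shows "(\<Sum>C | subset.chain L C \<and> \<Union>C = K. (-1) ^ card C) =
    (\<Sum>A | A \<subseteq> \<T> \<and> \<Union>A = K. (-1) ^ card A :: int)" (is "?m K = ?n K")
proof -
  have finL: "finite (insert {} L)"
    unfolding L_def by (rule finite_subset[of _ "Pow E"]) (auto simp: finite_ground)
  have finCs: "finite {C. subset.chain L C}"
    by (rule finite_subset[of _ "Pow L"]) (use finL in \<open>auto simp: subset_chain_def\<close>)
  have finT: "finite {A. A \<subseteq> \<T> \<and> Q A}" for Q
    by (rule finite_subset[of _ "Pow \<T>"]) (auto simp: finite_minimal_crowded)
  have Union_L: "\<Union>C \<in> insert {} L" if C: "subset.chain L C" for C
  proof (cases "C = {}")
    case False
    have "C \<subseteq> L" using C by (auto simp: subset_chain_def)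
    moreover have "finite C" using \<open>C \<subseteq> L\<close> finL finite_subset by auto
    ultimately show ?thesis using Union_in_chain[OF _ False C] by auto
  qed simp
  have Union_T: "\<Union>A \<in> insert {} L" if "A \<subseteq> \<T>" for A
    using Union_minimal_crowded_psubset[OF that] crowd_Union_minimal_crowded[OF that]
    by (auto simp: L_def)
  have "finite K" using assms(2) finite_ground finite_subset by (auto simp: L_def)
  then show ?thesis using assms(2)
  proof (induction K rule: finite_psubset_induct)
    case (psubset K)
    show ?case
    proof (cases "K = {}")
      case True
      have "{C. subset.chain L C \<and> \<Union>C = {}} = {{}}" by (auto simp: subset_chain_def L_def)
      moreover have "{A. A \<subseteq> \<T> \<and> \<Union>A = {}} = {{}}"
        using minimal_crowdedD(1) by auto
      ultimately show ?thesis using True by simp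
    next
      case False
      then have K: "K \<in> L" using psubset.prems by simp
      define D where "D = {C. subset.chain L C \<and> \<Union>C \<subset> K}"
      define L' where "L' = {K' \<in> insert {} L. K' \<subset> K}"
      have finD: "finite D" using finCs by (simp add: D_def)
      have K_notin: "K \<notin> C" "finite C" if "C \<in> D" for C
      proof -
        have C: "\<Union>C \<subset> K" "C \<subseteq> L" using that by (auto simp: D_def subset_chain_def)
        show "K \<notin> C" using C(1) by auto
        show "finite C" using C(2) finL finite_subset by auto
      qed
      \<comment> \<open>The union of a nonempty finite chain is its largest member, so deleting
        \<open>K\<close> leaves a chain with smaller union.\<close>
      have "{C. subset.chain L C \<and> \<Union>C = K} = insert K ` D"
      proof (intro set_eqI iffI)
        fix C assume "C \<in> {C. subset.chain L C \<and> \<Union>C = K}"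
        then have C: "subset.chain L C" "\<Union>C = K" by auto
        have "C \<subseteq> L" using C by (auto simp: subset_chain_def)
        then have "finite C" using finL finite_subset by auto
        moreover have "C \<noteq> {}" using C(2) False by auto
        ultimately have KC: "K \<in> C" using Union_in_chain[OF _ _ C(1)] C(2) by auto
        have chain': "subset.chain L (C - {K})" using C(1) by (auto simp: subset_chain_def)
        have "\<Union>(C - {K}) \<subset> K"
        proof -
          have "\<Union>(C - {K}) \<noteq> K"
          proof
            assume *: "\<Union>(C - {K}) = K"
            then have "C - {K} \<noteq> {}" using False by auto
            then have "K \<in> C - {K}" using Union_in_chain[OF _ _ chain'] \<open>finite C\<close> * by auto
            then show False by simp
          qed
          then show ?thesis using C(2) by auto
        qed
        then have "C - {K} \<in> D" using chain' by (simp add: D_def)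
        moreover have "C = insert K (C - {K})" using KC by auto
        ultimately show "C \<in> insert K ` D" by (metis image_eqI)
      next
        fix C assume "C \<in> insert K ` D"
        then obtain C' where C': "C = insert K C'" "subset.chain L C'" "\<Union>C' \<subset> K"
          by (auto simp: D_def)
        have "\<forall>X\<in>C'. X \<subseteq> K \<or> K \<subseteq> X" using C'(3) by auto
        then show "C \<in> {C. subset.chain L C \<and> \<Union>C = K}"
          using C' K by (auto simp: subset_chain_insert)
      qed
      then have "?m K = (\<Sum>C\<in>insert K ` D. (-1) ^ card C)" by simp
      also have "\<dots> = (\<Sum>C\<in>D. (-1) ^ card (insert K C))"
      proof (subst sum.reindex)
        show "inj_on (insert K) D"
          using K_notin(1) by (intro inj_onI) (metis insert_ident)
      qed simp
      also have "\<dots> = - (\<Sum>C\<in>D. (-1) ^ card C)"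
        using K_notin by (simp add: sum_negf)
      also have "(\<Sum>C\<in>D. (-1) ^ card C) = (\<Sum>K'\<in>L'. \<Sum>C | C \<in> D \<and> \<Union>C = K'. (-1) ^ card C :: int)"
        using finD finL Union_L by (intro sum.group[symmetric]) (auto simp: L'_def D_def)
      also have "\<dots> = (\<Sum>K'\<in>L'. ?n K')"
      proof (rule sum.cong[OF refl])
        fix K' assume K': "K' \<in> L'"
        then have "{C. C \<in> D \<and> \<Union>C = K'} = {C. subset.chain L C \<and> \<Union>C = K'}"
          by (auto simp: D_def L'_def)
        moreover have "?m K' = ?n K'" using K' by (intro psubset.IH) (auto simp: L'_def)
        ultimately show "(\<Sum>C | C \<in> D \<and> \<Union>C = K'. (-1) ^ card C) = ?n K'" by simp
      qed
      also have "\<dots> = (\<Sum>K'\<in>L'. \<Sum>A | A \<in> {A. A \<subseteq> \<T> \<and> \<Union>A \<subset> K} \<and> \<Union>A = K'. (-1) ^ card A)"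
        by (intro sum.cong refl arg_cong[where f = "sum _"]) (auto simp: L'_def)
      also have "\<dots> = (\<Sum>A | A \<subseteq> \<T> \<and> \<Union>A \<subset> K. (-1) ^ card A)"
        using finT finL Union_T by (intro sum.group) (auto simp: L'_def)
      also have "\<dots> = - ?n K"
      proof -
        have "K \<subseteq> E" "crowd indep K \<ge> 0" using K by (auto simp: L_def)
        then have "{T \<in> \<T>. T \<subseteq> K} \<noteq> {}"
          using minimal_crowded_exists[of K] False by auto
        then have "(\<Sum>A\<in>Pow {T \<in> \<T>. T \<subseteq> K}. (-1) ^ card A) = (0 :: int)"
          using finite_minimal_crowded by (intro sum_Pow_minus_one_power) auto
        moreover have "Pow {T \<in> \<T>. T \<subseteq> K} = {A. A \<subseteq> \<T> \<and> \<Union>A \<subset> K} \<union> {A. A \<subseteq> \<T> \<and> \<Union>A = K}"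
          by auto
        moreover have "(\<Sum>A\<in>{A. A \<subseteq> \<T> \<and> \<Union>A \<subset> K} \<union> {A. A \<subseteq> \<T> \<and> \<Union>A = K}. (-1) ^ card A) =
            (\<Sum>A | A \<subseteq> \<T> \<and> \<Union>A \<subset> K. (-1) ^ card A) + (?n K :: int)"
          using finT by (intro sum.union_disjoint) auto
        ultimately show ?thesis by simp
      qed
      finally show ?thesis by simp
    qed
  qed
qed

text \<open>The weight depends only on the union of the chain. Grouping by this union exchanges
  chains for families of minimal crowded sets, over which the rank is additive, leaving an affine
  alternating sum.\<close>

lemma sum_crowd_0_chains_eq_0:
  defines "L \<equiv> {S. S \<noteq> {} \<and> S \<subset> E \<and> crowd indep S = 0}"
  shows "(\<Sum>C | subset.chain L C. (-1) ^ card C * (int r - int (mrank indep (\<Union>C)))) = 0"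
proof -
  let ?F = "\<lambda>K. int r - int (mrank indep K)"
  have finL: "finite (insert {} L)"
    unfolding L_def by (rule finite_subset[of _ "Pow E"]) (auto simp: finite_ground)
  have finCs: "finite {C. subset.chain L C}"
    by (rule finite_subset[of _ "Pow L"]) (use finL in \<open>auto simp: subset_chain_def\<close>)
  have Union_L: "\<Union>C \<in> insert {} L" if C: "subset.chain L C" for C
  proof (cases "C = {}")
    case False
    have "C \<subseteq> L" using C by (auto simp: subset_chain_def)
    moreover have "finite C" using \<open>C \<subseteq> L\<close> finL finite_subset by auto
    ultimately show ?thesis using Union_in_chain[OF _ False C] by auto
  qed simp
  have Union_T: "\<Union>A \<in> insert {} L" if "A \<subseteq> \<T>" for A
    using Union_minimal_crowded_psubset[OF that] crowd_Union_minimal_crowded[OF that]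
    by (auto simp: L_def)
  have "(\<Sum>C | subset.chain L C. (-1) ^ card C * ?F (\<Union>C)) =
      (\<Sum>K\<in>insert {} L. \<Sum>C | C \<in> {C. subset.chain L C} \<and> \<Union>C = K. (-1) ^ card C * ?F (\<Union>C))"
    using finCs finL Union_L by (intro sum.group[symmetric]) auto
  also have "\<dots> = (\<Sum>K\<in>insert {} L. (\<Sum>C | subset.chain L C \<and> \<Union>C = K. (-1) ^ card C) * ?F K)"
    by (simp add: sum_distrib_right)
  also have "\<dots> = (\<Sum>K\<in>insert {} L. (\<Sum>A | A \<subseteq> \<T> \<and> \<Union>A = K. (-1) ^ card A) * ?F K)"
    using sum_chains_eq_sum_Union by (intro sum.cong refl) (simp add: L_def)
  also have "\<dots> = (\<Sum>K\<in>insert {} L. \<Sum>A | A \<in> Pow \<T> \<and> \<Union>A = K. (-1) ^ card A * ?F (\<Union>A))"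
    by (simp add: sum_distrib_right)
  also have "\<dots> = (\<Sum>A\<in>Pow \<T>. (-1) ^ card A * ?F (\<Union>A))"
    using finL Union_T finite_minimal_crowded by (intro sum.group) auto
  also have "\<dots> = (\<Sum>A\<in>Pow \<T>. (-1) ^ card A * (int r - (\<Sum>T\<in>A. int (mrank indep T))))"
    by (intro sum.cong refl) (simp add: mrank_Union_minimal_crowded)
  also have "\<dots> = 0"
    by (rule sum_Pow_affine_eq_0[OF finite_minimal_crowded card_minimal_crowded_ge_2])
  finally show ?thesis .
qed

end

section \<open>Nonbasis elements of an ordering\<close>

lemma permutationsD:
  assumes "w \<in> permutations_of_set E"
  shows "set w = E" "distinct w" "length w = card E"
  using permutations_of_setD[OF assms] distinct_card[of w] by auto

lemma order_basis_subset: "order_basis indep w \<subseteq> set w"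
  by (auto simp: order_basis_def)

context barely_crowded_matroid
begin

lemma set_take_eq_remove_last:
  assumes "w \<in> permutations_of_set E"
  shows "last w \<in> E" "set (take (card E - 1) w) = E - {last w}"
proof -
  note w = permutationsD[OF assms]
  have "w \<noteq> []" using w(3) card_ground by auto
  then have split: "w = butlast w @ [last w]" by simp
  show "last w \<in> E" using \<open>w \<noteq> []\<close> w(1) by auto
  have "set w = insert (last w) (set (butlast w))" "last w \<notin> set (butlast w)"
    using split w(2) by (metis list.simps(15) rotate1.simps(2) set_rotate1,
        metis distinct_append disjoint_iff list.set_intros(1))
  moreover have "take (card E - 1) w = butlast w" using w(3) by (simp add: butlast_conv_take)
  ultimately show "set (take (card E - 1) w) = E - {last w}" using w(1) by auto
qed

lemma card_Diff_order_basis_prefix: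
  assumes "w \<in> permutations_of_set E" "k \<le> card E"
  shows "int (card (set (take k w) - order_basis indep w)) =
    int (card (set (take k w))) - int (mrank indep (set (take k w)))"
proof -
  note w = permutationsD[OF assms(1)]
  let ?S = "set (take k w)" and ?B = "order_basis indep w"
  have "card ?S = card (?S - ?B) + card (?S \<inter> ?B)"
    by (subst card_Un_disjoint[symmetric]) (auto intro: arg_cong[where f = card])
  then show ?thesis
    using card_order_basis_prefix[OF w(2), of k] assms(2) w(3) by (simp add: Int_commute)
qed

lemma card_nonbasis:
  assumes "w \<in> permutations_of_set E"
  shows "card (E - order_basis indep w) = r + 1"
  using card_Diff_order_basis_prefix[OF assms, of "card E"] permutationsD[OF assms]
    mrank_ground card_ground by simp

text \<open>\<open>E - {last w}\<close> still has rank \<open>r\<close>, hence contains only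
  \<open>r\<close> of the \<open>r + 1\<close> nonbasis elements.\<close>

lemma last_nonbasis:
  assumes "w \<in> permutations_of_set E"
  shows "last w \<in> E - order_basis indep w"
proof -
  let ?B = "order_basis indep w"
  note last = set_take_eq_remove_last[OF assms]
  have "int (card ((E - {last w}) - ?B)) = int r"
    using card_Diff_order_basis_prefix[OF assms, of "card E - 1"] last mrank_remove[OF last(1)]
      card_ground finite_ground by simp
  moreover have "(E - {last w}) - ?B = (E - ?B) - {last w}" by auto
  ultimately show ?thesis
    using card_nonbasis[OF assms] by (cases "last w \<in> E - ?B") auto
qed

text \<open>Of the \<open>r + 1\<close> nonbasis elements, discard the last one and those in the
  prefix. The count depends on the prefix only as a set, not on its ordering.\<close>

lemma card_nonbasis_outside_prefix:
  assumes w: "w \<in> permutations_of_set E" and k: "k \<le> card E - 1"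
  shows "int (card (E - order_basis indep w - {last w} - set (take k w))) =
    int r - (int (card (set (take k w))) - int (mrank indep (set (take k w))))"
proof -
  let ?B = "order_basis indep w" and ?S = "set (take k w)"
  have "?S \<subseteq> set (take (card E - 1) w)" using k by (rule set_take_subset_set_take)
  then have S: "?S \<subseteq> E - {last w}" using set_take_eq_remove_last[OF w] by simp
  have "card (E - ?B) = card (insert (last w) (?S - ?B \<union> (E - ?B - {last w} - ?S)))"
    using S last_nonbasis[OF w] by (intro arg_cong[where f = card]) auto
  also have "\<dots> = Suc (card (?S - ?B \<union> (E - ?B - {last w} - ?S)))"
    using S finite_ground by (intro card_insert_disjoint) auto
  also have "card (?S - ?B \<union> (E - ?B - {last w} - ?S)) =
      card (?S - ?B) + card (E - ?B - {last w} - ?S)"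
    using finite_ground by (intro card_Un_disjoint) auto
  finally show ?thesis
    using card_nonbasis[OF w] card_Diff_order_basis_prefix[OF w, of k] k by simp
qed

text \<open>The product is 1 when every \<open>h S\<close> is nonnegative and \<open>d\<close>
  avoids the members with \<open>h S = 0\<close>, that is, \<open>d\<close> lies outside
  \<open>Z\<close>. So the sum counts nonbasis elements outside a prefix.\<close>

lemma sum_nonbasis_chain:
  fixes h :: "'a set \<Rightarrow> int"
  assumes w: "w \<in> permutations_of_set E" and C: "C \<subseteq> flag_set w ` {..<card E - 1}"
  defines "Z \<equiv> \<Union>{S \<in> C. h S = 0}"
  shows "(\<Sum>d\<in>E - order_basis indep w - {last w}. \<Prod>S\<in>C. of_bool (h S - of_bool (d \<in> S) \<ge> 0)) =
    (if \<forall>S\<in>C. h S \<ge> 0 then int r - (int (card Z) - int (mrank indep Z)) else 0)"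
proof -
  let ?D = "E - order_basis indep w - {last w}"
  have finC: "finite C" using C finite_subset by blast
  have "(\<Prod>S\<in>C. of_bool (h S - of_bool (d \<in> S) \<ge> 0)) =
      (of_bool ((\<forall>S\<in>C. h S \<ge> 0) \<and> d \<notin> Z) :: int)" for d
  proof -
    have "h S - of_bool (d \<in> S) \<ge> 0 \<longleftrightarrow> h S \<ge> 0 \<and> \<not> (h S = 0 \<and> d \<in> S)" for S by auto
    then have "(\<forall>S\<in>C. h S - of_bool (d \<in> S) \<ge> 0) \<longleftrightarrow> (\<forall>S\<in>C. h S \<ge> 0) \<and> d \<notin> Z"
      unfolding Z_def by auto
    moreover have "(\<Prod>S\<in>C. of_bool (Q S)) = (of_bool (\<forall>S\<in>C. Q S) :: int)" for Q
      using finC by (induction C) auto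
    ultimately show ?thesis by simp
  qed
  then have "(\<Sum>d\<in>?D. \<Prod>S\<in>C. of_bool (h S - of_bool (d \<in> S) \<ge> 0)) =
      (\<Sum>d\<in>?D. of_bool ((\<forall>S\<in>C. h S \<ge> 0) \<and> d \<notin> Z) :: int)"
    by simp
  also have "\<dots> = (if \<forall>S\<in>C. h S \<ge> 0 then int (card (?D - Z)) else 0)"
    using finite_ground by (auto simp: set_diff_eq conj_commute intro!: arg_cong[where f = card])
  also have "int (card (?D - Z)) = int r - (int (card Z) - int (mrank indep Z))"
  proof -
    \<comment> \<open>\<open>Z\<close> is the largest member with \<open>h = 0\<close>, or the empty
      prefix if there is none.\<close>
    obtain k where k: "k \<le> card E - 1" "Z = set (take k w)"
    proof (cases "{S \<in> C. h S = 0} = {}")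
      case True
      have "Z = set (take 0 w)" unfolding Z_def True by simp
      then show thesis using that[of 0] by simp
    next
      case False
      have "subset.chain UNIV {S \<in> C. h S = 0}"
        using flag_proper_chain[OF w C] unfolding subset_chain_def by simp
      then have "Z \<in> C"
        using Union_in_chain[OF _ False] finC unfolding Z_def by auto
      then have "Z \<in> flag_set w ` {..<card E - 1}" using C by (rule subsetD[rotated])
      then obtain i where "i < card E - 1" "Z = flag_set w i" by auto
      then show thesis using that[of "Suc i"] by (simp add: flag_set_def)
    qed
    then show ?thesis using card_nonbasis_outside_prefix[OF w k(1)] by simp
  qed
  finally show ?thesis .
qed

end

section \<open>Vanishing of each Laurent coefficient\<close>

context disjoint_crowded_matroid
begin

lemma sum_permutations_eq_0:
  fixes q :: "'a \<Rightarrow> int" and idx :: "'a \<Rightarrow> nat"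
  assumes inj: "inj_on idx E" and q: "(\<Sum>e\<in>E. q e) = 0"
  defines "h \<equiv> \<lambda>S. crowd indep S - (\<Sum>e\<in>S. q e)"
  shows "(\<Sum>w\<in>permutations_of_set E. \<Sum>d\<in>E - order_basis indep w - {last w}. \<Prod>i<card E - 1.
    of_bool (h (flag_set w i) - of_bool (d \<in> flag_set w i) \<ge> 0) -
    (of_bool (idx (w ! i) < idx (w ! Suc i)) :: int)) = 0"
proof -
  let ?Z = "\<lambda>C. \<Union>{S \<in> C. h S = 0}"
  let ?F = "\<lambda>Z. int r - (int (card Z) - int (mrank indep Z))"
  let ?P = "{S. S \<noteq> {} \<and> S \<subset> E \<and> h S \<ge> 0}"
  have "(\<Sum>C | proper_chain E C. (-1) ^ card C * (if \<forall>S\<in>C. h S \<ge> 0 then ?F (?Z C) else 0)) =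
      (\<Sum>C | subset.chain ?P C. (-1) ^ card C * ?F (?Z C))"
  proof (rule sum.mono_neutral_cong_right)
    show "finite {C. proper_chain E C}" by (rule finite_proper_chains[OF finite_ground])
    show "{C. subset.chain ?P C} \<subseteq> {C. proper_chain E C}"
      by (auto simp: subset_chain_def)
    show "\<forall>C\<in>{C. proper_chain E C} - {C. subset.chain ?P C}.
        (-1) ^ card C * (if \<forall>S\<in>C. h S \<ge> 0 then ?F (?Z C) else 0) = 0"
      by (auto simp: subset_chain_def)
    show "(-1) ^ card C * (if \<forall>S\<in>C. h S \<ge> 0 then ?F (?Z C) else 0) = (-1) ^ card C * ?F (?Z C)"
      if "C \<in> {C. subset.chain ?P C}" for C
      using that by (auto simp: subset_chain_def)
  qed
  also have "\<dots> = 0"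
  proof (cases "\<exists>b\<in>E. q b \<ge> 1")
    case True
    then obtain b where "b \<in> E" "q b \<ge> 1" by auto
    from sum_chains_eq_0[OF this q, of ?F] show ?thesis unfolding h_def .
  next
    case False
    then have "\<forall>e\<in>E. q e \<le> 0" by auto
    \<comment> \<open>The values are nonpositive on \<open>E\<close> and add up to zero.\<close>
    then have q0: "\<forall>e\<in>E. q e = 0"
      using q sum_nonneg_eq_0_iff[OF finite_ground, of "\<lambda>e. - q e"] by (simp add: sum_negf)
    have h: "h S = crowd indep S" if "S \<subset> E" for S
    proof -
      have "(\<Sum>e\<in>S. q e) = 0" using that q0 by (intro sum.neutral) auto
      then show ?thesis by (simp add: h_def)
    qed
    let ?L = "{S. S \<noteq> {} \<and> S \<subset> E \<and> crowd indep S = 0}"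
    have "h S \<ge> 0 \<longleftrightarrow> crowd indep S = 0" if S: "S \<subset> E" for S
      using h[OF S] crowd_le_0[OF S] by auto
    then have P: "?P = ?L" by (intro Collect_cong conj_cong refl)
    have "?F (?Z C) = int r - int (mrank indep (\<Union>C))" if C: "subset.chain ?L C" for C
    proof -
      have CL: "C \<subseteq> ?L" using C by (auto simp: subset_chain_def)
      have "h S = 0" if S: "S \<in> C" for S
      proof -
        have "S \<subset> E" "crowd indep S = 0" using subsetD[OF CL S] by auto
        then show ?thesis using h by simp
      qed
      then have "{S \<in> C. h S = 0} = C" by auto
      \<comment> \<open>Crowding zero means that the size is twice the rank, which turns the weight
        into \<open>r\<close> minus the rank.\<close>
      moreover have "crowd indep (\<Union>C) = 0"
      proof (cases "C = {}")
        case False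
        have "finite C" using CL finite_ground by (intro finite_subset[of C "Pow E"]) auto
        then show ?thesis using Union_in_chain[OF _ False C] CL by auto
      qed simp
      ultimately show ?thesis by (simp add: crowd_def)
    qed
    then have "(\<Sum>C | subset.chain ?P C. (-1) ^ card C * ?F (?Z C)) =
        (\<Sum>C | subset.chain ?L C. (-1) ^ card C * (int r - int (mrank indep (\<Union>C))))"
      unfolding P by (intro sum.cong refl) simp
    then show ?thesis using sum_crowd_0_chains_eq_0 by simp
  qed
  finally show ?thesis
    by (subst sum_permutations_eq_sum_chains[OF finite_ground inj sum_nonbasis_chain]) simp_all
qed

end
section \<open>Laurent expansions\<close>

text \<open>The coefficient at \<open>q\<close> of a polynomial times a formal Laurent series. The
  sum is finite because it runs over the support of the polynomial, so \<open>f\<close> may have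
  infinite support.\<close>

definition zact :: "zpoly \<Rightarrow> ((nat \<Rightarrow> int) \<Rightarrow> int) \<Rightarrow> (nat \<Rightarrow> int) \<Rightarrow> int" where
  "zact P f q = (\<Sum>m\<in>Poly_Mapping.keys P. Poly_Mapping.lookup P m * f (\<lambda>i. q i - int (Poly_Mapping.lookup m i)))"

lemma zact_superset:
  assumes "finite A" "Poly_Mapping.keys P \<subseteq> A"
  shows "zact P f q = (\<Sum>m\<in>A. Poly_Mapping.lookup P m * f (\<lambda>i. q i - int (Poly_Mapping.lookup m i)))"
  unfolding zact_def using assms by (intro sum.mono_neutral_left) (auto simp: in_keys_iff)

lemma zact_single: "zact (Poly_Mapping.single m c) f q = c * f (\<lambda>i. q i - int (Poly_Mapping.lookup m i))"
  by (subst zact_superset[of "{m}"]) auto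

lemma zact_add: "zact (P + Q) f q = zact P f q + zact Q f q"
proof -
  let ?A = "Poly_Mapping.keys P \<union> Poly_Mapping.keys Q"
  have "Poly_Mapping.keys (P + Q) \<subseteq> ?A" by (rule Poly_Mapping.keys_add)
  then show ?thesis
    by (simp add: zact_superset[of ?A] lookup_add algebra_simps sum.distrib)
qed

lemma zact_zero [simp]: "zact 0 f q = 0"
  by (simp add: zact_def)

lemma zact_one [simp]: "zact 1 f q = f q"
  by (simp add: zact_single flip: single_one)

lemma zact_diff: "zact (P - Q) f q = zact P f q - zact Q f q"
  using zact_add[of "P - Q" Q f q] by simp

lemma zact_add_right: "zact P (\<lambda>q. f q + g q) q = zact P f q + zact P g q"
  by (simp add: zact_def algebra_simps sum.distrib)

lemma zact_zero_right [simp]: "zact P (\<lambda>q. 0) q = 0"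
  by (simp add: zact_def)

lemma zpoly_induct [case_names zero add]:
  fixes P :: zpoly
  assumes "H 0" and "\<And>m c P. H P \<Longrightarrow> H (Poly_Mapping.single m c + P)"
  shows "H P"
proof (induction P rule: update_induct)
  case const
  show ?case using assms(1) by simp
next
  case (update P m c)
  then have "Poly_Mapping.update m c P = Poly_Mapping.single m c + P"
    by (intro poly_mapping_eqI) (auto simp: lookup_update lookup_add lookup_single when_def in_keys_iff)
  then show ?case using assms(2) update by simp
qed

text \<open>Polynomials act on series as a ring. By additivity in both factors it suffices to
  compare two monomials.\<close>

lemma zact_mult: "zact (P * Q) f q = zact P (zact Q f) q"
proof (induction P arbitrary: q rule: zpoly_induct)
  case (add m c P)
  have "zact (Poly_Mapping.single m c * Q) f q = zact (Poly_Mapping.single m c) (zact Q f) q" for q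
  proof (induction Q arbitrary: q rule: zpoly_induct)
    case (add m' c' Q)
    have "zact (Poly_Mapping.single m c * Poly_Mapping.single m' c') f q
        = zact (Poly_Mapping.single m c) (zact (Poly_Mapping.single m' c') f) q"
      by (simp add: mult_single zact_single lookup_add algebra_simps)
    then show ?case using add by (simp add: distrib_left zact_add zact_single)
  qed (simp add: zact_single)
  then show ?case using add by (simp add: distrib_right zact_add)
qed simp

text \<open>The coefficients of the series 1, so \<open>zact Q zdelta\<close> lists the coefficients
  of \<open>Q\<close> itself.\<close>

definition zdelta :: "(nat \<Rightarrow> int) \<Rightarrow> int" where
  "zdelta q = of_bool (q = (\<lambda>_. 0))"

lemma zact_zdelta_eq_0:
  assumes "\<And>q. zact P zdelta q = 0"
  shows "P = 0"
proof (rule poly_mapping_eqI)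
  fix m :: "nat \<Rightarrow>\<^sub>0 nat"
  let ?q = "\<lambda>i. int (Poly_Mapping.lookup m i)"
  have "zact P zdelta ?q = (\<Sum>k\<in>insert m (Poly_Mapping.keys P).
      Poly_Mapping.lookup P k * zdelta (\<lambda>i. ?q i - int (Poly_Mapping.lookup k i)))"
    by (rule zact_superset) auto
  also have "\<dots> = (\<Sum>k\<in>insert m (Poly_Mapping.keys P). if k = m then Poly_Mapping.lookup P m else 0)"
    by (intro sum.cong) (auto simp: zdelta_def fun_eq_iff intro!: poly_mapping_eqI)
  also have "\<dots> = Poly_Mapping.lookup P m" by simp
  finally show "Poly_Mapping.lookup P m = Poly_Mapping.lookup 0 m" using assms by simp
qed

text \<open>Expanding the denominators of a rational function as geometric series turns it into a formal
  Laurent series, but all Laurent series together do not form a ring. Hence \<open>f\<close> is only required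
  to become the numerator after multiplication by some denominator.\<close>

definition expands_to :: "zratfun \<Rightarrow> ((nat \<Rightarrow> int) \<Rightarrow> int) \<Rightarrow> bool" where
  "expands_to F f \<longleftrightarrow> (\<exists>P Q. P \<noteq> 0 \<and> F = Fract Q P \<and> (\<forall>q. zact P f q = zact Q zdelta q))"

lemma expands_to_zero: "expands_to 0 (\<lambda>q. 0)"
  unfolding expands_to_def by (intro exI[of _ 1] exI[of _ 0]) (simp add: Zero_fract_def)

lemma expands_to_one: "expands_to 1 zdelta"
  unfolding expands_to_def by (intro exI[of _ 1] exI[of _ 1]) (simp add: One_fract_def)

text \<open>A rational function can have several expansions, but the zero series forces the
  numerator to vanish. This is how an identity of coefficients returns to rational
  functions.\<close>

lemma expands_to_zeroD:
  assumes "expands_to F (\<lambda>q. 0)"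
  shows "F = 0"
proof -
  obtain P Q where P: "P \<noteq> 0" "F = Fract Q P" "\<And>q. zact Q zdelta q = 0"
    using assms unfolding expands_to_def by auto
  then show ?thesis using zact_zdelta_eq_0[of Q] by (simp add: Zero_fract_def eq_fract)
qed

lemma expands_to_add:
  assumes "expands_to F f" "expands_to G g"
  shows "expands_to (F + G) (\<lambda>q. f q + g q)"
proof -
  obtain P Q where P: "P \<noteq> 0" "F = Fract Q P" "zact P f = zact Q zdelta"
    using assms(1) unfolding expands_to_def by (auto simp: fun_eq_iff)
  obtain P' Q' where P': "P' \<noteq> 0" "G = Fract Q' P'" "zact P' g = zact Q' zdelta"
    using assms(2) unfolding expands_to_def by (auto simp: fun_eq_iff)
  have "zact (P * P') (\<lambda>q. f q + g q) q = zact (Q * P' + Q' * P) zdelta q" for q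
  proof -
    have "zact (P * P') f q = zact (Q * P') zdelta q"
      by (simp add: zact_mult P(3) mult.commute[of P] mult.commute[of Q])
    moreover have "zact (P * P') g q = zact (Q' * P) zdelta q"
      by (simp add: zact_mult P'(3) mult.commute[of Q'])
    ultimately show ?thesis by (simp add: zact_add_right zact_add)
  qed
  then show ?thesis
    unfolding expands_to_def using P P' by (intro exI[of _ "P * P'"] exI[of _ "Q * P' + Q' * P"]) auto
qed

lemma expands_to_sum:
  assumes "\<And>x. x \<in> A \<Longrightarrow> expands_to (F x) (f x)"
  shows "expands_to (\<Sum>x\<in>A. F x) (\<lambda>q. \<Sum>x\<in>A. f x q)"
  using assms
  by (induction A rule: infinite_finite_induct) (auto intro: expands_to_zero expands_to_add)

lemma expands_to_mult:
  assumes "expands_to F f"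
  shows "expands_to (Fract R 1 * F) (zact R f)"
proof -
  obtain P Q where P: "P \<noteq> 0" "F = Fract Q P" "zact P f = zact Q zdelta"
    using assms(1) unfolding expands_to_def by (auto simp: fun_eq_iff)
  have "zact P (zact R f) q = zact (R * Q) zdelta q" for q
    by (metis P(3) mult.commute zact_mult)
  then show ?thesis
    unfolding expands_to_def using P by (intro exI[of _ P] exI[of _ "R * Q"]) auto
qed

text \<open>Quotients of series are not unique, so \<open>g\<close> is specified by its product with
  \<open>R\<close>.\<close>

lemma expands_to_divide:
  assumes "expands_to F f" "R \<noteq> 0" "\<And>q. zact R g q = f q"
  shows "expands_to (F / Fract R 1) g"
proof -
  obtain P Q where P: "P \<noteq> 0" "F = Fract Q P" "zact P f = zact Q zdelta"
    using assms(1) unfolding expands_to_def by (auto simp: fun_eq_iff)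
  have "zact R g = f" using assms(3) by auto
  then have "zact (P * R) g q = zact Q zdelta q" for q
    using P(3) by (simp add: zact_mult)
  then show ?thesis
    unfolding expands_to_def using P assms(2)
    by (intro exI[of _ "P * R"] exI[of _ Q]) (auto simp: mult.commute)
qed

section \<open>Expansion of the denominators\<close>

abbreviation zmonom :: "(nat \<Rightarrow>\<^sub>0 nat) \<Rightarrow> zpoly" where
  "zmonom m \<equiv> Poly_Mapping.single m 1"

abbreviation zindet :: "nat \<Rightarrow> zpoly" where
  "zindet a \<equiv> zmonom (Poly_Mapping.single a 1)"

lemma zindet_diff_neq_0: "a \<noteq> b \<Longrightarrow> zindet a - zindet b \<noteq> 0"
proof
  assume "a \<noteq> b" "zindet a - zindet b = 0"
  then have "Poly_Mapping.lookup (zindet a - zindet b) (Poly_Mapping.single a 1) = 0" by simp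
  moreover have "Poly_Mapping.single b (1::nat) \<noteq> Poly_Mapping.single a 1"
    using \<open>a \<noteq> b\<close> by (metis lookup_single_eq lookup_single_not_eq zero_neq_one)
  ultimately show False by (simp add: lookup_minus lookup_single_not_eq)
qed

text \<open>The expansion of \<open>1 / (\<Prod>i. z (w ! i) - z (w ! Suc i))\<close> in which \<open>z b / z a\<close> is small for
  \<open>b < a\<close>. Both expansions of \<open>1 / (z a - z b)\<close> have the coefficient
  \<open>of_bool (k < 0) - of_bool (a < b)\<close> at \<open>z a ^ k * z b ^ (- k - 1)\<close>.\<close>

fun chain_coeff :: "nat list \<Rightarrow> (nat \<Rightarrow> int) \<Rightarrow> int" where
  "chain_coeff (a # b # w) q =
     (of_bool (q a < 0) - of_bool (a < b)) * chain_coeff (b # w) (q(a := 0, b := q b + q a + 1))"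
| "chain_coeff [b] q = zdelta q"
| "chain_coeff [] q = zdelta q"

lemma chain_coeff_support: "i \<notin> set w \<Longrightarrow> q i \<noteq> 0 \<Longrightarrow> chain_coeff w q = 0"
  by (induction w q rule: chain_coeff.induct) (auto simp: zdelta_def)

text \<open>The two shifts reach the same remaining coefficient, and their prefactors differ by the
  indicator of \<open>q a = 0\<close>. For other \<open>q\<close> the right-hand side vanishes too,
  since \<open>a\<close> does not occur in \<open>b # w\<close>.\<close>

lemma zact_zindet_diff_chain_coeff:
  assumes "distinct (a # b # w)"
  shows "zact (zindet a - zindet b) (chain_coeff (a # b # w)) q = chain_coeff (b # w) q"
proof -
  let ?q = "q(a := 0, b := q b + q a)"
  have A: "zact (zindet a) (chain_coeff (a # b # w)) q =
      (of_bool (q a - 1 < 0) - of_bool (a < b)) * chain_coeff (b # w) ?q"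
  proof -
    have "(\<lambda>i. q i - int (Poly_Mapping.lookup (Poly_Mapping.single a 1) i)) = q(a := q a - 1)"
      by (auto simp: lookup_single when_def)
    moreover have "(q(a := q a - 1))(a := 0, b := (q(a := q a - 1)) b + (q(a := q a - 1)) a + 1) = ?q"
      using assms by auto
    ultimately show ?thesis unfolding zact_single by simp
  qed
  have B: "zact (zindet b) (chain_coeff (a # b # w)) q =
      (of_bool (q a < 0) - of_bool (a < b)) * chain_coeff (b # w) ?q"
  proof -
    have "(\<lambda>i. q i - int (Poly_Mapping.lookup (Poly_Mapping.single b 1) i)) = q(b := q b - 1)"
      by (auto simp: lookup_single when_def)
    moreover have "(q(b := q b - 1))(a := 0, b := (q(b := q b - 1)) b + (q(b := q b - 1)) a + 1) = ?q"
      using assms by auto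
    ultimately show ?thesis using assms unfolding zact_single by simp
  qed
  show ?thesis
  proof (cases "q a = 0")
    case True
    then have "?q = q" by auto
    with True show ?thesis unfolding zact_diff A B by (simp add: algebra_simps)
  next
    case False
    moreover have "chain_coeff (b # w) q = 0"
      using assms False by (intro chain_coeff_support[of a]) auto
    ultimately show ?thesis unfolding zact_diff A B by (simp add: algebra_simps)
  qed
qed

lemma chain_coeff_trivial [simp]: "chain_coeff [] = zdelta" "chain_coeff [b] = zdelta"
  by auto

lemma expands_to_chain:
  assumes "distinct w"
  shows "expands_to (1 / (\<Prod>i<length w - 1. Fract (zindet (w ! i)) 1 - Fract (zindet (w ! Suc i)) 1))
    (chain_coeff w)"
  using assms
proof (induction w rule: induct_list012)
  case (3 a b w)
  let ?F = "\<lambda>w. \<Prod>i<length w - 1. Fract (zindet (w ! i)) 1 - Fract (zindet (w ! Suc i)) 1"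
  have "expands_to (1 / ?F (b # w) / Fract (zindet a - zindet b) 1) (chain_coeff (a # b # w))"
    using 3 by (intro expands_to_divide[where f = "chain_coeff (b # w)"] zact_zindet_diff_chain_coeff
        zindet_diff_neq_0) auto
  moreover have "?F (a # b # w) = ?F (b # w) * Fract (zindet a - zindet b) 1"
    by (simp add: prod.lessThan_Suc_shift del: prod.lessThan_Suc)
  ultimately show ?case unfolding divide_divide_eq_left by (simp only:)
qed (use expands_to_one in simp_all)

text \<open>Each step of the recursion carries the exponent of the head, plus 1, over to the next
  variable. At position \<open>i\<close> the accumulated exponent is thus a partial sum plus
  \<open>i\<close>; the total reflects that the denominator has degree
  \<open>length w - 1\<close>.\<close>

lemma chain_coeff_eq:
  assumes "distinct w" "w \<noteq> []"
  shows "chain_coeff w q =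
    (if (\<forall>i. i \<notin> set w \<longrightarrow> q i = 0) \<and> (\<Sum>i\<in>set w. q i) + int (length w) = 1
     then \<Prod>i<length w - 1. of_bool ((\<Sum>j\<le>i. q (w ! j)) + int i < 0) - of_bool (w ! i < w ! Suc i)
     else 0)"
  using assms
proof (induction w arbitrary: q rule: induct_list012)
  case (2 b)
  have "q = (\<lambda>_. 0) \<longleftrightarrow> (\<forall>i. i \<noteq> b \<longrightarrow> q i = 0) \<and> q b = 0" by auto
  then show ?case by (auto simp: zdelta_def)
next
  case (3 a b w)
  let ?q = "q(a := 0, b := q b + q a + 1)"
  have supp: "(\<forall>i. i \<notin> set (b # w) \<longrightarrow> ?q i = 0) \<longleftrightarrow> (\<forall>i. i \<notin> set (a # b # w) \<longrightarrow> q i = 0)"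
    using "3.prems" by auto
  have "(\<Sum>i\<in>set w. ?q i) = (\<Sum>i\<in>set w. q i)"
    using "3.prems" by (intro sum.cong) auto
  then have total: "(\<Sum>i\<in>set (b # w). ?q i) + int (length (b # w)) =
      (\<Sum>i\<in>set (a # b # w). q i) + int (length (a # b # w))"
    using "3.prems" by simp
  \<comment> \<open>The carried amount \<open>q a + 1\<close> enters every partial sum, which
    amounts to shifting the index by one.\<close>
  have part: "(\<Sum>j\<le>i. ?q ((b # w) ! j)) + int i = (\<Sum>j\<le>Suc i. q ((a # b # w) ! j)) + int (Suc i)"
    if "i < length (b # w)" for i
  proof -
    have "(\<Sum>j\<le>i. ?q ((b # w) ! j)) = (\<Sum>j\<le>i. q ((b # w) ! j) + (if j = 0 then q a + 1 else 0))"
      using that "3.prems" by (intro sum.cong refl) (auto simp: nth_Cons split: nat.split)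
    then show ?thesis by (simp add: sum.distrib sum.atMost_Suc_shift del: sum.atMost_Suc)
  qed
  let ?f = "\<lambda>i. of_bool ((\<Sum>j\<le>i. q ((a # b # w) ! j)) + int i < 0)
    - (of_bool ((a # b # w) ! i < (a # b # w) ! Suc i) :: int)"
  have prods: "(\<Prod>i<length (b # w) - 1. of_bool ((\<Sum>j\<le>i. ?q ((b # w) ! j)) + int i < 0)
          - of_bool ((b # w) ! i < (b # w) ! Suc i)) = (\<Prod>i<length (b # w) - 1. ?f (Suc i))"
    by (intro prod.cong refl) (subst part, auto)
  have IH: "chain_coeff (b # w) ?q =
    (if (\<forall>i. i \<notin> set (a # b # w) \<longrightarrow> q i = 0) \<and>
        (\<Sum>i\<in>set (a # b # w). q i) + int (length (a # b # w)) = 1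
     then \<Prod>i<length (b # w) - 1. ?f (Suc i) else 0)"
    unfolding supp[symmetric] total[symmetric] prods[symmetric]
    by (rule "3.IH"(2)) (use "3.prems" in auto)
  have "(\<Prod>i<length (a # b # w) - 1. ?f i) =
      (of_bool (q a < 0) - of_bool (a < b)) * (\<Prod>i<length (b # w) - 1. ?f (Suc i))"
    by (simp add: prod.lessThan_Suc_shift del: prod.lessThan_Suc sum.atMost_Suc)
  then show ?case
    unfolding chain_coeff.simps IH by (auto simp only: mult_zero_right split: if_split)
qed simp

section \<open>Vanishing of omega\<close>

lemma elem_sym_0 [simp]: "finite A \<Longrightarrow> elem_sym 0 A v = 1"
proof -
  assume "finite A"
  then have "{S. S \<subseteq> A \<and> card S = 0} = {{}}" by (auto simp: finite_subset)
  then show ?thesis by (simp add: elem_sym_def)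
qed

lemma elem_sym_card:
  assumes "finite A"
  shows "elem_sym (card A) A v = (\<Prod>i\<in>A. v i)"
proof -
  have "{S. S \<subseteq> A \<and> card S = card A} = {A}" using assms card_subset_eq by auto
  then show ?thesis by (simp add: elem_sym_def)
qed

lemma elem_sym_insert:
  assumes "finite A" "a \<notin> A"
  shows "elem_sym (Suc k) (insert a A) v = elem_sym (Suc k) A v + v a * elem_sym k A v"
proof -
  let ?S = "\<lambda>k. {S. S \<subseteq> A \<and> card S = k}"
  have fin: "finite S" if "S \<subseteq> A" for S using that assms finite_subset by auto
  have "{S. S \<subseteq> insert a A \<and> card S = Suc k} = ?S (Suc k) \<union> insert a ` ?S k"
  proof (intro set_eqI iffI)
    fix S assume S: "S \<in> {S. S \<subseteq> insert a A \<and> card S = Suc k}"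
    show "S \<in> ?S (Suc k) \<union> insert a ` ?S k"
    proof (cases "a \<in> S")
      case True
      then have "S = insert a (S - {a})" "S - {a} \<in> ?S k" using S by auto
      then show ?thesis by blast
    qed (use S in auto)
  next
    fix S assume "S \<in> ?S (Suc k) \<union> insert a ` ?S k"
    then show "S \<in> {S. S \<subseteq> insert a A \<and> card S = Suc k}"
      using assms fin by (auto simp: card_insert_if)
  qed
  moreover have "(\<Sum>S\<in>?S (Suc k) \<union> insert a ` ?S k. prod v S) =
      (\<Sum>S\<in>?S (Suc k). prod v S) + (\<Sum>S\<in>insert a ` ?S k. prod v S)"
    using assms by (intro sum.union_disjoint) auto
  moreover have "(\<Sum>S\<in>insert a ` ?S k. prod v S) = (\<Sum>S\<in>?S k. prod v (insert a S))"
  proof (subst sum.reindex)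
    show "inj_on (insert a) (?S k)"
    proof (rule inj_onI)
      fix S S' assume "S \<in> ?S k" "S' \<in> ?S k" "insert a S = insert a S'"
      moreover from this have "a \<notin> S" "a \<notin> S'" using assms(2) by auto
      ultimately show "S = S'" by (simp add: insert_ident)
    qed
  qed simp
  moreover have "(\<Sum>S\<in>?S k. prod v (insert a S)) = (\<Sum>S\<in>?S k. v a * prod v S)"
    using assms fin by (intro sum.cong refl prod.insert) auto
  ultimately show ?thesis by (simp add: elem_sym_def sum_distrib_left)
qed

text \<open>Dividing \<open>\<Prod>i\<in>insert a A. 1 + v i * t\<close> by \<open>1 + v a * t\<close>.\<close>

lemma sum_powers_elem_sym_insert:
  assumes "finite A" "a \<notin> A"
  shows "(\<Sum>j=0..k. (- v a) ^ j * elem_sym (k - j) (insert a A) v) = elem_sym k A v"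
proof (induction k)
  case (Suc k)
  have "(\<Sum>j=0..Suc k. (- v a) ^ j * elem_sym (Suc k - j) (insert a A) v) =
      elem_sym (Suc k) (insert a A) v - v a * (\<Sum>j=0..k. (- v a) ^ j * elem_sym (k - j) (insert a A) v)"
    by (subst sum.atLeast0_atMost_Suc_shift) (simp add: sum_distrib_left mult.assoc sum_negf)
  then show ?case using Suc assms by (simp add: elem_sym_insert)
qed (use assms in simp)

lemma elem_sym_card_pred:
  assumes "finite A" "card A = Suc k"
  shows "elem_sym k A v = (\<Sum>d\<in>A. \<Prod>i\<in>A - {d}. v i)"
proof -
  have "{S. S \<subseteq> A \<and> card S = k} = (\<lambda>d. A - {d}) ` A"
  proof (intro set_eqI iffI)
    fix S assume "S \<in> {S. S \<subseteq> A \<and> card S = k}"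
    then have S: "S \<subseteq> A" "card S = k" by auto
    then have "card (A - S) = 1" using assms by (simp add: card_Diff_subset finite_subset)
    then obtain d where d: "A - S = {d}" by (auto simp: card_1_singleton_iff)
    then have "S = A - {d}" "d \<in> A" using S by auto
    then show "S \<in> (\<lambda>d. A - {d}) ` A" by auto
  qed (use assms in auto)
  moreover have "inj_on (\<lambda>d. A - {d}) A" by (auto simp: inj_on_def)
  ultimately show ?thesis by (simp add: elem_sym_def sum.reindex)
qed

section \<open>Exponents of the numerator monomials\<close>

lemma prod_zvar:
  "(\<Prod>e\<in>A. zvar E e) = Fract (zmonom (\<Sum>e\<in>A. Poly_Mapping.single (to_nat_on E e) 1)) 1"
  by (induction A rule: infinite_finite_induct)
    (auto simp: zvar_def mult_single One_fract_def)

lemma lookup_sum_single: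
  assumes "finite A" "inj_on idx E" "A \<subseteq> E" "e \<in> E"
  shows "Poly_Mapping.lookup (\<Sum>e\<in>A. Poly_Mapping.single (idx e) (1::nat)) (idx e) = of_bool (e \<in> A)"
proof -
  have "Poly_Mapping.lookup (Poly_Mapping.single (idx e') (1::nat)) (idx e) = (if e' = e then 1 else 0)"
    if "e' \<in> A" for e'
    using that assms by (auto simp: lookup_single when_def inj_on_eq_iff)
  then show ?thesis using assms(1) by (simp add: lookup_sum)
qed

lemma lookup_sum_single_outside:
  assumes "i \<notin> idx ` A"
  shows "Poly_Mapping.lookup (\<Sum>e\<in>A. Poly_Mapping.single (idx e) (1::nat)) i = 0"
  using assms by (auto simp: lookup_sum lookup_single when_def intro!: sum.neutral)

lemma coeff_monom_power_mult_const:
  "coeff ((- monom 1 1) ^ i * [:c:]) k = (if i = k then (-1) ^ k * c else (0 :: 'a::comm_ring_1))"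
proof -
  have "(- monom 1 1 :: 'a poly) ^ i = monom ((-1) ^ i) i"
    by (simp add: minus_monom monom_power)
  then show ?thesis by (auto simp: coeff_monom_mult coeff_pCons split: nat.split)
qed

context disjoint_crowded_matroid
begin

text \<open>Up to sign the first product is the elementary symmetric polynomial in \<open>y\<close>,
  and the second is one term of that of degree \<open>r - 1\<close> in the nonbasis variables other
  than the last. All Laurent coefficients of the sum are shown to vanish.\<close>

lemma sum_monomials_eq_0:
  "(\<Sum>w\<in>permutations_of_set E. \<Sum>d\<in>E - order_basis indep w - {last w}.
      (\<Prod>e\<in>E - order_basis indep w. zvar E e) * (\<Prod>e\<in>E - order_basis indep w - {last w} - {d}. zvar E e) *
      (1 / (\<Prod>i<card E - 1. zvar E (w ! i) - zvar E (w ! Suc i)))) = 0"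
    (is "(\<Sum>w\<in>_. \<Sum>d\<in>_. ?X w d * ?Y w d * (1 / ?P w)) = 0")
proof -
  let ?B = "order_basis indep" and ?idx = "to_nat_on E"
  have inj: "inj_on ?idx E" using finite_ground countable_finite inj_on_to_nat_on by blast
  define m1 where "m1 w = (\<Sum>e\<in>E - ?B w. Poly_Mapping.single (?idx e) (1::nat))" for w
  define m2 where "m2 w d = (\<Sum>e\<in>E - ?B w - {last w} - {d}. Poly_Mapping.single (?idx e) (1::nat))" for w d
  have numerator: "?X w d * ?Y w d = Fract (zmonom (m1 w + m2 w d)) 1" for w d
    by (simp add: prod_zvar m1_def m2_def mult_single)
  let ?f = "\<lambda>w d q. chain_coeff (map ?idx w) (\<lambda>i. q i - int (Poly_Mapping.lookup (m1 w + m2 w d) i))"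
  have exp1: "expands_to (?X w d * ?Y w d * (1 / ?P w)) (?f w d)"
    if w: "w \<in> permutations_of_set E" for w d
  proof -
    note w' = permutationsD[OF w]
    have "distinct (map ?idx w)" using w' inj by (simp add: distinct_map)
    from expands_to_mult[OF expands_to_chain[OF this], of "zmonom (m1 w + m2 w d)"]
    have "expands_to (Fract (zmonom (m1 w + m2 w d)) 1 *
        (1 / (\<Prod>i<length (map ?idx w) - 1. Fract (zindet (map ?idx w ! i)) 1 - Fract (zindet (map ?idx w ! Suc i)) 1)))
        (zact (zmonom (m1 w + m2 w d)) (chain_coeff (map ?idx w)))" .
    moreover have "(\<Prod>i<length (map ?idx w) - 1. Fract (zindet (map ?idx w ! i)) 1 - Fract (zindet (map ?idx w ! Suc i)) 1) = ?P w"
      using w'(3) by (intro prod.cong) (auto simp: zvar_def)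
    moreover have "zact (zmonom (m1 w + m2 w d)) (chain_coeff (map ?idx w)) = ?f w d"
      by (simp add: fun_eq_iff zact_single)
    ultimately show ?thesis unfolding numerator by (simp only:)
  qed
  have "expands_to (\<Sum>w\<in>permutations_of_set E. \<Sum>d\<in>E - ?B w - {last w}. ?X w d * ?Y w d * (1 / ?P w))
      (\<lambda>q. \<Sum>w\<in>permutations_of_set E. \<Sum>d\<in>E - ?B w - {last w}. ?f w d q)"
    by (intro expands_to_sum exp1)
  moreover have "(\<Sum>w\<in>permutations_of_set E. \<Sum>d\<in>E - ?B w - {last w}. ?f w d q) = 0" for q
  proof -
    define q' where "q' e = q (?idx e)" for e
    define h where "h S = crowd indep S - (\<Sum>e\<in>S. q' e)" for S
    have coeff: "?f w d q = (if (\<forall>i. i \<notin> ?idx ` E \<longrightarrow> q i = 0) \<and> (\<Sum>e\<in>E. q' e) = 0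
        then \<Prod>i<card E - 1. of_bool (h (flag_set w i) - of_bool (d \<in> flag_set w i) \<ge> 0) -
          of_bool (?idx (w ! i) < ?idx (w ! Suc i)) else 0)"
      if w: "w \<in> permutations_of_set E" and d: "d \<in> E - ?B w - {last w}" for w d
    proof -
      note w' = permutationsD[OF w]
      let ?m = "\<lambda>i. Poly_Mapping.lookup (m1 w + m2 w d) i"
      let ?q = "\<lambda>i. q i - int (?m i)"
      have m_out: "?m i = 0" if i: "i \<notin> ?idx ` E" for i
      proof -
        have i': "i \<notin> ?idx ` (E - ?B w)" "i \<notin> ?idx ` (E - ?B w - {last w} - {d})" using i by auto
        show ?thesis
          unfolding m1_def m2_def lookup_add i'[THEN lookup_sum_single_outside] by simp
      qed
      have m_in: "?m (?idx e) = of_bool (e \<in> E - ?B w) + of_bool (e \<in> E - ?B w - {last w} - {d})"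
        if e: "e \<in> E" for e
        unfolding m1_def m2_def lookup_add
        using finite_ground e
        by (subst (1 2) lookup_sum_single[OF _ inj]) auto
      have sum_m: "(\<Sum>e\<in>S. ?q (?idx e)) = (\<Sum>e\<in>S. q' e) - int (card (S - ?B w)) -
          int (card (S - ?B w - {last w} - {d}))" if S: "S \<subseteq> E" for S
      proof -
        have finS: "finite S" using S finite_ground finite_subset by auto
        have count: "(\<Sum>e\<in>S. of_bool (e \<in> X)) = int (card X)" if "X \<subseteq> S" for X
          using finS that by (simp add: Int_absorb1)
        have "(\<Sum>e\<in>S. ?q (?idx e)) = (\<Sum>e\<in>S. q' e - (of_bool (e \<in> S - ?B w) +
            of_bool (e \<in> S - ?B w - {last w} - {d})))"
          using S m_in by (intro sum.cong refl) (auto simp: q'_def)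
        also have "\<dots> = (\<Sum>e\<in>S. q' e) - ((\<Sum>e\<in>S. of_bool (e \<in> S - ?B w)) +
            (\<Sum>e\<in>S. of_bool (e \<in> S - ?B w - {last w} - {d})))"
          by (simp only: sum_subtractf sum.distrib)
        also have "(\<Sum>e\<in>S. of_bool (e \<in> S - ?B w)) = int (card (S - ?B w))"
          by (rule count) auto
        also have "(\<Sum>e\<in>S. of_bool (e \<in> S - ?B w - {last w} - {d})) = int (card (S - ?B w - {last w} - {d}))"
          by (rule count) auto
        finally show ?thesis by simp
      qed
      have last: "last w \<in> E - ?B w" by (rule last_nonbasis[OF w])
      \<comment> \<open>The numerator has degree \<open>(r + 1) + (r - 1)\<close>, the same as the
        denominator, so only exponent vectors of sum zero contribute.\<close>
      have total: "(\<Sum>i\<in>?idx ` E. ?q i) + int (card E) = (\<Sum>e\<in>E. q' e) + 1"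
      proof -
        have "card (E - ?B w - {last w} - {d}) + 2 = r + 1"
          using card_nonbasis[OF w] last d finite_ground rank_pos by (simp add: card_Diff_singleton)
        then show ?thesis
          using sum_m[of E] card_nonbasis[OF w] card_ground by (simp add: sum.reindex[OF inj])
      qed
      \<comment> \<open>With \<open>S\<close> the prefix, which omits \<open>last w\<close>, the
        numerator contributes \<open>2 * (card S - rank S)\<close>, less 1 if \<open>d\<close> lies
        in \<open>S\<close>. As \<open>card S = i + 1\<close>, the left-hand quantity is
        \<open>-1\<close> minus the one on the right, so the strict bound becomes a weak
        one.\<close>
      have part: "(\<Sum>j\<le>i. ?q (map ?idx w ! j)) + int i < 0 \<longleftrightarrow>
          h (flag_set w i) - of_bool (d \<in> flag_set w i) \<ge> 0" if i: "i < card E - 1" for i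
      proof -
        let ?S = "flag_set w i"
        have "?S \<subseteq> set (take (card E - 1) w)"
          unfolding flag_set_def using i by (intro set_take_subset_set_take) simp
        then have S: "?S \<subseteq> E - {last w}" using set_take_eq_remove_last[OF w] by simp
        have cS: "card ?S = Suc i" using w' i by (intro card_flag_set) auto
        have "(\<Sum>j\<le>i. ?q (map ?idx w ! j)) = (\<Sum>j\<le>i. ?q (?idx (w ! j)))"
          using w'(3) i by (intro sum.cong) auto
        also have "\<dots> = (\<Sum>e\<in>(\<lambda>j. w ! j) ` {..i}. ?q (?idx e))"
          using w'(2,3) i by (subst sum.reindex) (auto simp: inj_on_def nth_eq_iff_index_eq)
        also have "(\<lambda>j. w ! j) ` {..i} = ?S"
          unfolding flag_set_def using w'(3) i by (simp add: nth_image[symmetric] lessThan_Suc_atMost atLeast0LessThan)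
        finally have 1: "(\<Sum>j\<le>i. ?q (map ?idx w ! j)) = (\<Sum>e\<in>?S. q' e) - int (card (?S - ?B w)) -
          int (card (?S - ?B w - {last w} - {d}))"
          using sum_m[of ?S] S by auto
        have 2: "int (card (?S - ?B w - {last w} - {d})) = int (card (?S - ?B w)) - of_bool (d \<in> ?S)"
        proof (cases "d \<in> ?S")
          case True
          then have "d \<in> ?S - ?B w" using d by auto
          then have "card (?S - ?B w) = Suc (card (?S - ?B w - {d}))"
            by (intro card.remove) (simp_all add: flag_set_def)
          moreover have "?S - ?B w - {last w} - {d} = ?S - ?B w - {d}" using S by auto
          ultimately show ?thesis using True by simp
        next
          case False
          then have "?S - ?B w - {last w} - {d} = ?S - ?B w" using S by auto
          then show ?thesis using False by simp
        qed
        have 3: "int (card (?S - ?B w)) = int (Suc i) - int (mrank indep ?S)"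
          using card_Diff_order_basis_prefix[OF w, of "Suc i"] i cS by (simp add: flag_set_def)
        show ?thesis using cS unfolding 1 2 3 h_def crowd_def by auto
      qed
      have "distinct (map ?idx w)" "map ?idx w \<noteq> []"
        using w' inj card_ground by (auto simp: distinct_map)
      note cc = chain_coeff_eq[OF this, of ?q]
      have "(\<forall>i. i \<notin> set (map ?idx w) \<longrightarrow> ?q i = 0) \<longleftrightarrow> (\<forall>i. i \<notin> ?idx ` E \<longrightarrow> q i = 0)"
        using m_out w'(1) by auto
      moreover have "(\<Sum>i\<in>set (map ?idx w). ?q i) + int (length (map ?idx w)) = 1 \<longleftrightarrow> (\<Sum>e\<in>E. q' e) = 0"
        using total w'(1,3) by simp
      moreover have "(\<Prod>i<length (map ?idx w) - 1. of_bool ((\<Sum>j\<le>i. ?q (map ?idx w ! j)) + int i < 0) -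
            of_bool (map ?idx w ! i < map ?idx w ! Suc i)) =
          (\<Prod>i<card E - 1. of_bool (h (flag_set w i) - of_bool (d \<in> flag_set w i) \<ge> 0) -
            (of_bool (?idx (w ! i) < ?idx (w ! Suc i)) :: int))"
        using w'(3) by (intro prod.cong) (auto simp only: part length_map lessThan_iff, auto)
      ultimately show ?thesis using cc by (simp only:)
    qed
    show ?thesis
    proof (cases "(\<forall>i. i \<notin> ?idx ` E \<longrightarrow> q i = 0) \<and> (\<Sum>e\<in>E. q' e) = 0")
      case True
      then have "(\<Sum>w\<in>permutations_of_set E. \<Sum>d\<in>E - ?B w - {last w}. ?f w d q) =
          (\<Sum>w\<in>permutations_of_set E. \<Sum>d\<in>E - ?B w - {last w}. \<Prod>i<card E - 1.
            of_bool (h (flag_set w i) - of_bool (d \<in> flag_set w i) \<ge> 0) -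
            of_bool (?idx (w ! i) < ?idx (w ! Suc i)))"
        using coeff by (intro sum.cong refl) simp
      also have "\<dots> = 0"
        using sum_permutations_eq_0[OF inj, of q'] True unfolding h_def by simp
      finally show ?thesis .
    next
      case False
      have "?f w d q = 0" if "w \<in> permutations_of_set E" "d \<in> E - ?B w - {last w}" for w d
        unfolding coeff[OF that] using False by (simp only: if_False)
      then show ?thesis by (intro sum.neutral ballI)
    qed
  qed
  ultimately show ?thesis using expands_to_zeroD by simp
qed

lemma omega_eq_0: "omega E indep = 0"
proof (cases "\<exists>e. loop E indep e \<or> coloop E indep e")
  case True
  then show ?thesis using card_ground by (auto simp: omega_def g_poly_def)
next
  case False
  let ?B = "order_basis indep"
  define f where "f i w = (\<Sum>j=0..i - 1. (- zvar E (last w)) ^ j *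
    elem_sym (i - j - 1) (E - ?B w) (\<lambda>e. - (- zvar E e)) * elem_sym (r - i) (?B w) (zvar E) *
    elem_sym (card E - r) (E - ?B w) (\<lambda>e. - zvar E e))" for i w
  \<comment> \<open>With the sum over \<open>j\<close> inside \<open>deg\<close>, the powers of
    \<open>- zvar E (last w)\<close> can be summed for each ordering separately.\<close>
  have deg_sum: "(\<Sum>j\<in>J. [:deg E (F j):]) = [:deg E (\<lambda>w. \<Sum>j\<in>J. F j w):]" for J :: "nat set" and F
  proof -
    have "(\<Sum>j\<in>J. [:deg E (F j):]) = [:\<Sum>j\<in>J. deg E (F j):]"
      by (induction J rule: infinite_finite_induct) auto
    also have "(\<Sum>j\<in>J. deg E (F j)) = deg E (\<lambda>w. \<Sum>j\<in>J. F j w)"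
      unfolding deg_def by (subst sum.swap) (simp add: sum_divide_distrib)
    finally show ?thesis .
  qed
  have "E \<noteq> {}" using card_ground by auto
  then have g: "g_poly E indep = (-1) ^ num_components E indep *
      (\<Sum>i=1..r. (- monom 1 1) ^ i * [:deg E (f i):])"
    using False mrank_ground by (simp add: g_poly_def Let_def deg_sum f_def[abs_def])
  have "f r w / (\<Prod>i<card E - 1. zvar E (w ! i) - zvar E (w ! Suc i)) =
      (-1) ^ (r + 1) * (\<Sum>d\<in>E - ?B w - {last w}. (\<Prod>e\<in>E - ?B w. zvar E e) *
        (\<Prod>e\<in>E - ?B w - {last w} - {d}. zvar E e) *
        (1 / (\<Prod>i<card E - 1. zvar E (w ! i) - zvar E (w ! Suc i))))"
    if w: "w \<in> permutations_of_set E" for w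
  proof -
    let ?A = "E - ?B w - {last w}"
    have A: "finite ?A" "last w \<notin> ?A" "insert (last w) ?A = E - ?B w"
      using finite_ground last_nonbasis[OF w] by auto
    have "card (insert (last w) ?A) = r + 1" unfolding A(3) by (rule card_nonbasis[OF w])
    then have cA: "card ?A = Suc (r - 1)"
      unfolding card_insert_disjoint[OF A(1,2)] using rank_pos by linarith
    have finB: "finite (?B w)"
      using order_basis_subset[of indep w] by (rule finite_subset) simp
    \<comment> \<open>Here \<open>card E - r = r + 1\<close> is the number of nonbasis elements, so
      only the full product occurs.\<close>
    have "elem_sym (card E - r) (E - ?B w) (\<lambda>e. - zvar E e) = (-1) ^ (r + 1) * (\<Prod>e\<in>E - ?B w. zvar E e)"
      using elem_sym_card[of "E - ?B w" "\<lambda>e. - zvar E e"] finite_ground card_nonbasis[OF w] card_ground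
      by (simp add: prod_uminus)
    then have "f r w = (\<Sum>j=0..r - 1. (- zvar E (last w)) ^ j *
        elem_sym (r - 1 - j) (insert (last w) ?A) (zvar E)) * ((-1) ^ (r + 1) * (\<Prod>e\<in>E - ?B w. zvar E e))"
      unfolding f_def A(3) using finB by (simp add: sum_distrib_right mult.assoc sum_negf)
    \<comment> \<open>The alternating powers remove the variable of \<open>last w\<close> from the
      elementary symmetric polynomial.\<close>
    also have "(\<Sum>j=0..r - 1. (- zvar E (last w)) ^ j *
        elem_sym (r - 1 - j) (insert (last w) ?A) (zvar E)) = elem_sym (r - 1) ?A (zvar E)"
      by (rule sum_powers_elem_sym_insert[OF A(1,2)])
    also have "\<dots> = (\<Sum>d\<in>?A. \<Prod>e\<in>?A - {d}. zvar E e)"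
      by (rule elem_sym_card_pred[OF A(1) cA])
    finally show ?thesis
      by (simp add: sum_distrib_left sum_distrib_right sum_divide_distrib mult_ac)
  qed
  then have "deg E (f r) = (-1) ^ (r + 1) * 0"
    unfolding deg_def sum_monomials_eq_0[symmetric] sum_distrib_left[of _ _ "permutations_of_set E"]
    by (intro sum.cong refl)
  \<comment> \<open>Only the summand \<open>i = r\<close> reaches this coefficient.\<close>
  then have "coeff (\<Sum>i=1..r. (- monom 1 1) ^ i * [:deg E (f i):]) r = 0"
    by (simp only: coeff_sum coeff_monom_power_mult_const) simp
  then show ?thesis
    unfolding omega_def mrank_ground g by (cases "even (num_components E indep)") simp_all
qed

end

theorem proposition12p6:
  fixes E :: "'a set" and indep :: "'a set \<Rightarrow> bool" and r p :: nat and T :: "nat \<Rightarrow> 'a set"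
  assumes "matroid E indep"
    and "connected_matroid E indep"
    and "mrank indep E = r" and "r > 0"
    and "card E = 2 * r + 1"
    and "\<forall>S. S \<subset> E \<longrightarrow> crowd indep S \<le> 0"
    and "bij_betw T {1..p} (minimal_crowded E indep)"
    and "\<forall>i\<in>{1..p}. \<forall>j\<in>{1..p}. i \<noteq> j \<longrightarrow> T i \<inter> T j = {}"
  shows "{S. crowding_record E indep S \<and> crowd indep S = 0} = {\<Union>i\<in>I. T i | I. I \<subseteq> {1..p}}
    \<and> omega E indep = 0"
proof -
  interpret matroid E indep by fact
  have minimal: "minimal_crowded E indep = T ` {1..p}"
    using assms(7) by (simp add: bij_betw_def)
  interpret disjoint_crowded_matroid E indep r
  proof
    show "pairwise disjnt (minimal_crowded E indep)"
    proof (rule pairwiseI)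
      fix A B assume AB: "A \<in> minimal_crowded E indep" "B \<in> minimal_crowded E indep" "A \<noteq> B"
      obtain i j where ij: "i \<in> {1..p}" "j \<in> {1..p}" "A = T i" "B = T j"
        using AB(1,2) unfolding minimal by (elim imageE)
      moreover have "i \<noteq> j" using AB(3) ij(3,4) by auto
      ultimately show "disjnt A B" using assms(8) by (simp add: disjnt_def)
    qed
  qed (use assms in auto)
  have "{\<Union>i\<in>I. T i | I. I \<subseteq> {1..p}} = Union ` Pow (minimal_crowded E indep)"
    unfolding minimal image_Pow_surj[OF refl, symmetric] image_image by auto
  then show ?thesis using crowding_records_eq omega_eq_0 by simp
qed

end
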